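(* Let $k\ge1$, $d\ge0$, and let $\mathscr R$ be a finite set of homogeneous relations (in the sense of the context). Then $$\operatorname{rank}M(k,d)\le\mathcal W_k^{(1)}(d)-\delta_{\mathscr R}^{(1)}(k,d)\le\min\{\mathcal W_k^{(1)}(d),\ \mathcal W_k(d)-\Delta_{\mathscr R}\}.$$
   Context: $\mathbb N$ includes $0$. $\mathcal P_k=\mathbb F_2[x_1,\dots,x_k]$ with $\deg x_i=1$; $\mathcal P_k^n$ is the degree-$n$ part (zero for $n<0$), $N_k(n)=\dim\mathcal P_k^n$. For $e\in\mathbb N^k$, $x^e=\prod x_i^{e_i}$, $|e|=\sum e_i$. The mod-2 Steenrod algebra $\mathcal A$ acts by $\mathrm{Sq}^r(x^a)=\sum_{b\in\mathbb N^k,|b|=r}\prod_i\binom{a_i}{b_i}x^{a+b}$ (mod 2), with $(\theta\eta)(f)=\theta(\eta(f))$. Hit matrix: $V(k,d)=\bigoplus_{t\ge0,\,2^t\le d}\mathcal P_k^{d-2^t}$ and $M(k,d)$ is the matrix in monomial bases of $\Phi_{k,d}:V(k,d)\to\mathcal P_k^d$, $(g_t)_t\mapsto\sum_t\mathrm{Sq}^{2^t}(g_t)$, its columns labelled by $(t,g)$ with $g$ a monomial of degree $d-2^t$. Counts: $\rho_k(n)=\operatorname{rank}(\mathrm{Sq}^1:\mathcal P_k^n\to\mathcal P_k^{n+1})$. $Z_t(k,S)$ is the number of degree-$S$ monomials $g\in\mathcal P_k$ with $\mathrm{Sq}^{2^t}(g)=0$ (zero for $S<0$). $$\mathcal W_k(d)=\sum_{t\ge0,\,2^t\le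 d}\bigl(N_k(d-2^t)-Z_t(k,d-2^t)\bigr),$$ $$\mathcal W_k^{(1)}(d)=\rho_k(d-1)+\sum_{t\ge1,\,2^t\le d}\bigl(N_k(d-2^t)-Z_t(k,d-2^t)\bigr)\quad(d\ge1),\qquad \mathcal W_k^{(1)}(0)=0.$$ Relations: a homogeneous relation of degree $a>0$ is a finitely supported tuple $\Theta=(\Theta_t)_{t\ge0}$ of homogeneous elements of $\mathcal A$, with $|\Theta_t|=a-2^t$ for nonzero entries, such that $\sum_t\mathrm{Sq}^{2^t}\Theta_t=0$ in $\mathcal A$. For $d\ge a$, $\Psi_{\Theta,d}:\mathcal P_k^{d-a}\to V(k,d)$ sends $f$ to $(\Theta_t(f))_t$; its image is set to zero when $d<a$. $E_0\subseteq V(k,d)$ is the coordinate subspace spanned by the labels $(t,g)$ with $\mathrm{Sq}^{2^t}(g)=0$. Put $K_{\mathscr R}=\sum_{\Theta\in\mathscr R}\operatorname{im}\Psi_{\Theta,d}$ and $\Delta_{\mathscr R}=\dim(E_0+K_{\mathscr R})-\dim E_0$. Let $\Theta^{(1)}$ be the degree-2 relation whose only nonzero entry is $\Theta_0=\mathrm{Sq}^1$ (from $\mathrm{Sq}^1\mathrm{Sq}^1=0$), $F_1=E_0+\operatorname{im}\Psi_{\Theta^{(1)},d}$, and $\delta^{(1)}_{\mathscr R}(k,d)=\dim(F_1+K_{\mathscr R})-\dim F_1$. *)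

theory Defs
  imports
    "HOL-Library.Poly_Mapping"
    "HOL-Library.Z2"
    "HOL-Library.Set_Algebras"
    "Jordan_Normal_Form.DL_Rank"
begin

section \<open>Vector spaces over the field with two elements\<close>

text \<open>
  The field is \<^typ>\<open>bit\<close>. A vector space over it is the same thing as an abelian group of
  exponent two, the scalar action being forced; this gives one generic instance of the
  library's \<^locale>\<open>vector_space\<close> for all the spaces below.
\<close>

class f2_space = ab_group_add +
  assumes add_self [simp]: "x + x = 0"

definition f2_scale :: "bit \<Rightarrow> 'a::f2_space \<Rightarrow> 'a"  (infixr \<open>\<cdot>\<close> 75)
  where "c \<cdot> v = (if c = 0 then 0 else v)"

lemma f2_scale_simps [simp]: "0 \<cdot> v = 0" "1 \<cdot> v = v" "c \<cdot> 0 = 0"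
  by (simp_all add: f2_scale_def)

lemma f2_scale_add_right: "c \<cdot> (v + w) = c \<cdot> v + c \<cdot> w"
  by (simp add: f2_scale_def)

lemma f2_scale_add_left: "(c + d) \<cdot> v = c \<cdot> v + d \<cdot> v"
  by (cases c; cases d) simp_all

interpretation F2: vector_space "f2_scale :: bit \<Rightarrow> 'a::f2_space \<Rightarrow> 'a"
proof unfold_locales
  fix c d :: bit and v w :: 'a
  show "c \<cdot> (v + w) = c \<cdot> v + c \<cdot> w" by (rule f2_scale_add_right)
  show "(c + d) \<cdot> v = c \<cdot> v + d \<cdot> v" by (rule f2_scale_add_left)
  show "c \<cdot> (d \<cdot> v) = (c * d) \<cdot> v" by (cases c; cases d) simp_all
  show "1 \<cdot> v = v" by simp
qed

lemma f2_add_self_left [simp]: "x + (x + y) = (y :: 'a::f2_space)"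
  by (simp flip: add.assoc)

lemma f2_uminus [simp]: "- x = (x :: 'a::f2_space)"
  by (metis add_self minus_unique)

lemma f2_minus: "x - y = (x + y :: 'a::f2_space)"
  by (metis f2_uminus uminus_add_conv_diff add.commute)

instance bit :: f2_space
proof
  show "x + x = 0" for x :: bit by (cases x) simp_all
qed

instance poly_mapping :: (type, f2_space) f2_space
  by standard (rule poly_mapping_eqI, simp add: lookup_add)

text \<open>
  The linear extension of a map given on a basis: an element of \<^typ>\<open>'a \<Rightarrow>\<^sub>0 bit\<close> is the sum
  of the basis elements in its support.
\<close>

definition f2_ext :: "('a \<Rightarrow> 'b::f2_space) \<Rightarrow> ('a \<Rightarrow>\<^sub>0 bit) \<Rightarrow> 'b"
  where "f2_ext h x = (\<Sum>w\<in>Poly_Mapping.keys x. h w)"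

lemma f2_ext_alt:
  assumes "finite A" "Poly_Mapping.keys x \<subseteq> A"
  shows "f2_ext h x = (\<Sum>w\<in>A. Poly_Mapping.lookup x w \<cdot> h w)"
proof -
  have "f2_ext h x = (\<Sum>w\<in>Poly_Mapping.keys x. Poly_Mapping.lookup x w \<cdot> h w)"
    unfolding f2_ext_def by (rule sum.cong) (auto simp: f2_scale_def in_keys_iff)
  also have "\<dots> = (\<Sum>w\<in>A. Poly_Mapping.lookup x w \<cdot> h w)"
    using assms by (intro sum.mono_neutral_left) (auto simp: in_keys_iff)
  finally show ?thesis .
qed

lemma f2_ext_zero [simp]: "f2_ext h 0 = 0"
  by (simp add: f2_ext_def)

lemma f2_ext_single [simp]: "f2_ext h (Poly_Mapping.single w c) = c \<cdot> h w"
  by (cases c) (simp_all add: f2_ext_def)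

lemma f2_ext_add: "f2_ext h (x + y) = f2_ext h x + f2_ext h y"
proof -
  let ?A = "Poly_Mapping.keys x \<union> Poly_Mapping.keys y"
  have "f2_ext h (x + y) = (\<Sum>w\<in>?A. Poly_Mapping.lookup (x + y) w \<cdot> h w)"
    by (intro f2_ext_alt) (simp_all add: keys_add)
  also have "\<dots> = (\<Sum>w\<in>?A. Poly_Mapping.lookup x w \<cdot> h w) + (\<Sum>w\<in>?A. Poly_Mapping.lookup y w \<cdot> h w)"
    by (simp only: lookup_add f2_scale_add_left sum.distrib)
  also have "(\<Sum>w\<in>?A. Poly_Mapping.lookup x w \<cdot> h w) = f2_ext h x"
    by (rule f2_ext_alt[symmetric]) simp_all
  also have "(\<Sum>w\<in>?A. Poly_Mapping.lookup y w \<cdot> h w) = f2_ext h y"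
    by (rule f2_ext_alt[symmetric]) simp_all
  finally show ?thesis .
qed

lemma f2_ext_cong: "(\<And>w. h w = h' w) \<Longrightarrow> f2_ext h x = f2_ext h' x"
  by (simp add: f2_ext_def)

lemma f2_ext_add_fun: "f2_ext (\<lambda>w. h w + h' w) x = f2_ext h x + f2_ext h' x"
  by (simp add: f2_ext_def sum.distrib)

lemma f2_expand: "f2_ext (\<lambda>w. Poly_Mapping.single w 1) x = x"
proof (rule poly_mapping_eqI)
  fix k
  show "Poly_Mapping.lookup (f2_ext (\<lambda>w. Poly_Mapping.single w 1) x) k = Poly_Mapping.lookup x k"
    by (auto simp: f2_ext_def lookup_sum lookup_single when_def in_keys_iff)
qed

lemma f2_induct [case_names zero add]:
  assumes "P 0" "\<And>w x. P x \<Longrightarrow> P (Poly_Mapping.single w 1 + x)"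
  shows "P (x :: 'a \<Rightarrow>\<^sub>0 bit)"
proof -
  have "P (\<Sum>w\<in>A. Poly_Mapping.single w 1)" if "finite A" for A
    using that by induction (auto intro: assms)
  from this[of "Poly_Mapping.keys x"] show ?thesis
    using f2_expand[of x] by (simp add: f2_ext_def)
qed

section \<open>Polynomials and Steenrod squares\<close>

text \<open>
  The variables $x_1,\dots,x_k$ are numbered $0,\dots,k-1$; exponent vectors in $\mathbb N^k$
  are the elements of \<^typ>\<open>nat \<Rightarrow>\<^sub>0 nat\<close> supported in \<^term>\<open>{..<k}\<close>.
\<close>

type_synonym expo = "nat \<Rightarrow>\<^sub>0 nat"
type_synonym pol = "expo \<Rightarrow>\<^sub>0 bit"

definition expos :: "nat \<Rightarrow> nat \<Rightarrow> expo set"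
  where "expos k n = {e. Poly_Mapping.keys e \<subseteq> {..<k} \<and> (\<Sum>i<k. Poly_Mapping.lookup e i) = n}"

definition xpow :: "expo \<Rightarrow> pol"
  where "xpow e = Poly_Mapping.single e 1"

definition Pol :: "nat \<Rightarrow> nat \<Rightarrow> pol set"
  where "Pol k n = {p. Poly_Mapping.keys p \<subseteq> expos k n}"

definition sq_xpow :: "nat \<Rightarrow> nat \<Rightarrow> expo \<Rightarrow> pol"
  where "sq_xpow k r a =
    (\<Sum>b\<in>expos k r.
       of_nat (\<Prod>i<k. Poly_Mapping.lookup a i choose Poly_Mapping.lookup b i) \<cdot> xpow (a + b))"

text \<open>
  The operation $\mathrm{Sq}^r$ on polynomials in $k$ variables. On polynomials involving further
  variables it treats those as constants; this plays no role below.
\<close>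

definition Sq :: "nat \<Rightarrow> nat \<Rightarrow> pol \<Rightarrow> pol"
  where "Sq k r p = f2_ext (sq_xpow k r) p"

lemma expos_lookup_beyond: "e \<in> expos k n \<Longrightarrow> \<not> i < k \<Longrightarrow> Poly_Mapping.lookup e i = 0"
  by (auto simp: expos_def in_keys_iff)

lemma finite_expos [simp]: "finite (expos k n)"
proof (rule finite_imageD)
  let ?r = "\<lambda>e. restrict (Poly_Mapping.lookup e) {..<k} :: nat \<Rightarrow> nat"
  have "?r ` expos k n \<subseteq> PiE {..<k} (\<lambda>_. {..n})"
    by (auto simp: expos_def PiE_iff extensional_def intro: member_le_sum split: if_splits)
  then show "finite (?r ` expos k n)"
    by (rule finite_subset) (simp add: finite_PiE)
  show "inj_on ?r (expos k n)"
  proof (rule inj_onI, rule poly_mapping_eqI)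
    fix a b i
    assume a: "a \<in> expos k n" and b: "b \<in> expos k n" and eq: "?r a = ?r b"
    show "Poly_Mapping.lookup a i = Poly_Mapping.lookup b i"
    proof (cases "i < k")
      case True
      then show ?thesis using fun_cong[OF eq, of i] by simp
    next
      case False
      then show ?thesis
        using expos_lookup_beyond[OF a] expos_lookup_beyond[OF b] by simp
    qed
  qed
qed

lemma Sq_add: "Sq k r (p + q) = Sq k r p + Sq k r q"
  by (simp add: Sq_def f2_ext_add)

lemma Sq_zero [simp]: "Sq k r 0 = 0"
  by (simp add: Sq_def)

lemma Sq_xpow: "Sq k r (xpow a) = sq_xpow k r a"
  by (simp add: Sq_def xpow_def)

lemma expos_0: "expos k 0 = {0}"
proof -
  have "e = 0" if e: "e \<in> expos k 0" for e
  proof (rule poly_mapping_eqI)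
    fix i
    show "Poly_Mapping.lookup e i = Poly_Mapping.lookup 0 i"
    proof (cases "i < k")
      case True
      then show ?thesis using e by (simp add: expos_def)
    next
      case False
      then show ?thesis using expos_lookup_beyond[OF e] by simp
    qed
  qed
  then show ?thesis by (auto simp: expos_def)
qed

lemma Sq_0: "Sq k 0 p = p"
proof -
  have "sq_xpow k 0 = xpow"
    by (rule ext) (simp add: sq_xpow_def expos_0)
  then show ?thesis
    unfolding Sq_def by (simp only: xpow_def[abs_def] f2_expand)
qed

subsection \<open>The Cartan formula for a variable\<close>

lemma xpow_mult: "xpow a * xpow b = xpow (a + b)"
  by (simp add: xpow_def mult_single)

lemma mult_f2_scale: "x * (c \<cdot> y) = c \<cdot> (x * (y :: pol))"
  by (simp add: f2_scale_def)

abbreviation var :: "nat \<Rightarrow> pol"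
  where "var i \<equiv> xpow (Poly_Mapping.single i (Suc 0))"

definition bcoeff :: "nat \<Rightarrow> expo \<Rightarrow> expo \<Rightarrow> nat"
  where "bcoeff k a b = (\<Prod>i<k. Poly_Mapping.lookup a i choose Poly_Mapping.lookup b i)"

lemma bcoeff_step:
  assumes "i < k"
  shows "bcoeff k (Poly_Mapping.single i (Suc 0) + a) b = bcoeff k a b +
    (if Poly_Mapping.lookup b i = 0 then 0 else bcoeff k a (b - Poly_Mapping.single i (Suc 0)))"
proof -
  define Q where "Q = (\<Prod>j\<in>{..<k} - {i}. Poly_Mapping.lookup a j choose Poly_Mapping.lookup b j)"
  have split: "bcoeff k a' b' = (Poly_Mapping.lookup a' i choose Poly_Mapping.lookup b' i) *
      (\<Prod>j\<in>{..<k} - {i}. Poly_Mapping.lookup a' j choose Poly_Mapping.lookup b' j)" for a' b'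
    unfolding bcoeff_def using assms by (subst prod.remove[of _ i]) auto
  have 1: "bcoeff k (Poly_Mapping.single i (Suc 0) + a) b =
      (Suc (Poly_Mapping.lookup a i) choose Poly_Mapping.lookup b i) * Q"
    unfolding split Q_def by (auto simp: lookup_add lookup_single intro!: prod.cong)
  have 2: "bcoeff k a b = (Poly_Mapping.lookup a i choose Poly_Mapping.lookup b i) * Q"
    unfolding split Q_def by simp
  have 3: "bcoeff k a (b - Poly_Mapping.single i (Suc 0)) =
      (Poly_Mapping.lookup a i choose (Poly_Mapping.lookup b i - 1)) * Q"
    unfolding split Q_def by (auto simp: lookup_minus lookup_single intro!: prod.cong)
  show ?thesis
    unfolding 1 2 3 by (cases "Poly_Mapping.lookup b i") (auto simp: algebra_simps)
qed

lemma sq_xpow_bcoeff: "sq_xpow k r a = (\<Sum>b\<in>expos k r. of_nat (bcoeff k a b) \<cdot> xpow (a + b))"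
  by (simp add: sq_xpow_def bcoeff_def)

lemma sum_single_lessThan: "i < (k::nat) \<Longrightarrow> (\<Sum>j<k. Poly_Mapping.lookup (Poly_Mapping.single i (Suc 0)) j) = 1"
proof -
  assume "i < k"
  have "(\<Sum>j<k. Poly_Mapping.lookup (Poly_Mapping.single i (Suc 0)) j) =
      (\<Sum>j\<in>{i}. Poly_Mapping.lookup (Poly_Mapping.single i (Suc 0)) j)"
    using \<open>i < k\<close> by (intro sum.mono_neutral_right) (auto simp: lookup_single_not_eq)
  then show ?thesis by simp
qed

lemma expos_add_single:
  assumes "i < k"
  shows "Poly_Mapping.single i (Suc 0) + b \<in> expos k (Suc r) \<longleftrightarrow> b \<in> expos k r"
proof -
  have "Poly_Mapping.keys (Poly_Mapping.single i (Suc 0) + b) = insert i (Poly_Mapping.keys b)"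
    by (auto simp: in_keys_iff lookup_add lookup_single when_def split: if_splits)
  then show ?thesis
    using assms sum_single_lessThan[OF assms] by (simp add: expos_def lookup_add sum.distrib)
qed

lemma sq_xpow_var:
  assumes "i < k"
  shows "sq_xpow k (Suc r) (Poly_Mapping.single i (Suc 0) + a) =
    var i * sq_xpow k (Suc r) a + var i * var i * sq_xpow k r a"
proof -
  let ?e = "Poly_Mapping.single i (Suc 0) :: expo"
  let ?B = "{b \<in> expos k (Suc r). Poly_Mapping.lookup b i \<noteq> 0}"
  have "sq_xpow k (Suc r) (?e + a) =
      (\<Sum>b\<in>expos k (Suc r). of_nat (bcoeff k a b) \<cdot> xpow (?e + a + b)) +
      (\<Sum>b\<in>expos k (Suc r).
         of_nat (if Poly_Mapping.lookup b i = 0 then 0 else bcoeff k a (b - ?e)) \<cdot> xpow (?e + a + b))"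
    unfolding sq_xpow_bcoeff bcoeff_step[OF assms] of_nat_add f2_scale_add_left sum.distrib ..
  also have "(\<Sum>b\<in>expos k (Suc r). of_nat (bcoeff k a b) \<cdot> xpow (?e + a + b)) = var i * sq_xpow k (Suc r) a"
    by (simp add: sq_xpow_bcoeff sum_distrib_left mult_f2_scale xpow_mult add.assoc)
  also have "(\<Sum>b\<in>expos k (Suc r).
         of_nat (if Poly_Mapping.lookup b i = 0 then 0 else bcoeff k a (b - ?e)) \<cdot> xpow (?e + a + b)) =
      (\<Sum>b\<in>?B. of_nat (bcoeff k a (b - ?e)) \<cdot> xpow (?e + a + b))"
    by (intro sum.mono_neutral_cong_right) auto
  also have "\<dots> = (\<Sum>b\<in>expos k r. of_nat (bcoeff k a b) \<cdot> xpow (?e + a + (?e + b)))"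
  proof (rule sum.reindex_bij_witness[of _ "\<lambda>b. ?e + b" "\<lambda>b. b - ?e"])
    fix b assume b: "b \<in> ?B"
    show eq: "?e + (b - ?e) = b"
      using b by (intro poly_mapping_eqI) (auto simp: lookup_add lookup_minus lookup_single when_def)
    show "b - ?e \<in> expos k r"
      using b expos_add_single[OF assms, of "b - ?e" r] unfolding eq by simp
    show "of_nat (bcoeff k a (b - ?e)) \<cdot> xpow (?e + a + (?e + (b - ?e))) =
        of_nat (bcoeff k a (b - ?e)) \<cdot> xpow (?e + a + b)"
      unfolding eq ..
  next
    fix b assume "b \<in> expos k r"
    then show "?e + b \<in> ?B" "?e + b - ?e = b"
      using expos_add_single[OF assms, of b r] by (simp_all add: lookup_add)
  qed
  also have "\<dots> = var i * var i * sq_xpow k r a"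
    by (simp only: sq_xpow_bcoeff sum_distrib_left mult_f2_scale xpow_mult) (simp add: ac_simps)
  finally show ?thesis .
qed

lemma sq_xpow_const:
  assumes "\<not> i < k"
  shows "sq_xpow k r (Poly_Mapping.single i (Suc 0) + a) = var i * sq_xpow k r a"
proof -
  have "bcoeff k (Poly_Mapping.single i (Suc 0) + a) b = bcoeff k a b" for b
    unfolding bcoeff_def using assms
    by (intro prod.cong) (auto simp: lookup_add lookup_single when_def)
  then show ?thesis
    by (simp add: sq_xpow_bcoeff sum_distrib_left mult_f2_scale xpow_mult add.assoc)
qed

lemma Sq_var: "i < k \<Longrightarrow> Sq k (Suc r) (var i * p) = var i * Sq k (Suc r) p + var i * var i * Sq k r p"
proof (induction p rule: f2_induct)
  case (add w x)
  have "Sq k (Suc r) (var i * xpow w) = var i * Sq k (Suc r) (xpow w) + var i * var i * Sq k r (xpow w)"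
    by (simp only: xpow_mult Sq_xpow sq_xpow_var[OF add.prems])
  with add show ?case
    unfolding xpow_def[of w, symmetric] by (simp add: Sq_add algebra_simps)
qed simp

lemma Sq_const: "\<not> i < k \<Longrightarrow> Sq k r (var i * p) = var i * Sq k r p"
proof (induction p rule: f2_induct)
  case (add w x)
  have "Sq k r (var i * xpow w) = var i * Sq k r (xpow w)"
    by (simp only: xpow_mult Sq_xpow sq_xpow_const[OF add.prems])
  with add show ?case
    unfolding xpow_def[of w, symmetric] by (simp add: Sq_add algebra_simps)
qed simp

lemma Sq_one: "Sq k (Suc r) 1 = 0"
proof -
  have "bcoeff k 0 b = 0" if "b \<in> expos k (Suc r)" for b
  proof -
    have "\<exists>i<k. Poly_Mapping.lookup b i \<noteq> 0"
      using that by (rule contrapos_pp) (auto simp: expos_def)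
    then show ?thesis
      by (auto simp: bcoeff_def intro!: prod_zero)
  qed
  then have "sq_xpow k (Suc r) 0 = 0"
    by (simp add: sq_xpow_bcoeff)
  then show ?thesis
    using Sq_xpow[of k "Suc r" 0] by (simp add: xpow_def)
qed

subsection \<open>The Adem relations hold for the action on polynomials\<close>

definition SqZ :: "nat \<Rightarrow> int \<Rightarrow> pol \<Rightarrow> pol"
  where "SqZ k r p = (if r < 0 then 0 else Sq k (nat r) p)"

definition adem_c :: "int \<Rightarrow> int \<Rightarrow> int \<Rightarrow> bit"
  where "adem_c a b j = (if 0 \<le> j \<and> 2 * j \<le> a then of_nat (nat (b - 1 - j) choose nat (a - 2 * j)) else 0)"

lemma SqZ_add: "SqZ k r (p + q) = SqZ k r p + SqZ k r q"
  by (simp add: SqZ_def Sq_add)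

lemma SqZ_zero [simp]: "SqZ k r 0 = 0"
  by (simp add: SqZ_def)

lemma SqZ_neg: "r < 0 \<Longrightarrow> SqZ k r p = 0"
  by (simp add: SqZ_def)

lemma SqZ_var:
  assumes "i < k"
  shows "SqZ k r (var i * p) = var i * SqZ k r p + var i * var i * SqZ k (r - 1) p"
proof (cases "r \<le> 0")
  case True
  then show ?thesis by (cases "r = 0") (simp_all add: SqZ_def Sq_0)
next
  case False
  then have "nat r = Suc (nat (r - 1))" by simp
  with False Sq_var[OF assms, of "nat (r - 1)" p] show ?thesis
    by (simp add: SqZ_def)
qed

lemma SqZ_const: "\<not> i < k \<Longrightarrow> SqZ k r (var i * p) = var i * SqZ k r p"
  by (simp add: SqZ_def Sq_const)

definition SqSq :: "nat \<Rightarrow> int \<Rightarrow> int \<Rightarrow> pol \<Rightarrow> pol"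
  where "SqSq k a b p = SqZ k a (SqZ k b p)"

lemma SqSq_add: "SqSq k a b (p + q) = SqSq k a b p + SqSq k a b q"
  by (simp add: SqSq_def SqZ_add)

lemma SqSq_zero [simp]: "SqSq k a b 0 = 0"
  by (simp add: SqSq_def)

lemma SqSq_const: "\<not> i < k \<Longrightarrow> SqSq k a b (var i * p) = var i * SqSq k a b p"
  by (simp add: SqSq_def SqZ_const)

lemma SqSq_var:
  assumes "i < k"
  shows "SqSq k a b (var i * p) = var i * SqSq k a b p
    + var i * var i * (SqSq k (a - 1) b p + SqSq k a (b - 1) p)
    + var i * var i * var i * var i * SqSq k (a - 2) (b - 1) p"
proof -
  have sq: "SqZ k a (var i * var i * q) =
      var i * var i * SqZ k a q + var i * var i * var i * var i * SqZ k (a - 2) q" for q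
  proof -
    have "SqZ k a (var i * (var i * q)) =
        var i * (var i * SqZ k a q + var i * var i * SqZ k (a - 1) q)
        + var i * var i * (var i * SqZ k (a - 1) q + var i * var i * SqZ k (a - 1 - 1) q)"
      by (simp only: SqZ_var[OF assms])
    also have "\<dots> = var i * var i * SqZ k a q
        + (var i * var i * var i * SqZ k (a - 1) q + var i * var i * var i * SqZ k (a - 1) q)
        + var i * var i * var i * var i * SqZ k (a - 2) q"
      by (simp only: distrib_left ac_simps diff_diff_eq one_add_one)
    finally show ?thesis by (simp only: add_self add_0_right mult.assoc)
  qed
  show ?thesis
    unfolding SqSq_def SqZ_var[OF assms, of b] SqZ_add sq SqZ_var[OF assms, of a]
    by (simp only: distrib_left ac_simps)
qed

definition adem_rhs :: "nat \<Rightarrow> int \<Rightarrow> int \<Rightarrow> pol \<Rightarrow> pol"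
  where "adem_rhs k a b p = (\<Sum>j\<in>{0..a}. adem_c a b j \<cdot> SqSq k (a + b - j) j p)"

lemma adem_c_out: "j < 0 \<or> a < 2 * j \<Longrightarrow> adem_c a b j = 0"
  by (auto simp: adem_c_def)

lemma adem_rhs_alt:
  assumes "l \<le> 0" "a \<le> m"
  shows "adem_rhs k a b p = (\<Sum>j\<in>{l..m}. adem_c a b j \<cdot> SqSq k (a + b - j) j p)"
  unfolding adem_rhs_def using assms
  by (intro sum.mono_neutral_left) (auto simp: adem_c_def)

lemma of_nat_choose_rec:
  assumes "0 \<le> n" 
  shows "of_nat (nat (n + 1) choose nat (m + 1)) =
    (of_nat (nat n choose nat (m + 1)) + (if m < 0 then 0 else of_nat (nat n choose nat m)) :: bit)"
proof (cases "m < 0")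
  case True
  then show ?thesis by simp
next
  case False
  then have "nat (n + 1) = Suc (nat n)" "nat (m + 1) = Suc (nat m)" using assms by simp_all
  with False show ?thesis by (simp only: if_False binomial_Suc_Suc of_nat_add add.commute)
qed

text \<open>
  The coefficient identity behind the induction step, away from the boundary.
\<close>

lemma adem_c_step:
  assumes "a < 2 * b - 2" "0 \<le> j"
  shows "adem_c (a - 1) b j + adem_c a (b - 1) j = adem_c a b j + adem_c a b (j + 1)"
proof (cases "0 \<le> j \<and> 2 * j \<le> a")
  case True
  define n where "n = b - 2 - j"
  define m where "m = a - 2 * j"
  have n: "0 \<le> n" and m: "0 \<le> m" using True assms by (auto simp: n_def m_def)
  have e: "b - 1 - j = n + 1" "b - 1 - 1 - j = n" "a - 2 * j = m" "a - 1 - 2 * j = m - 1"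
    "b - 1 - (j + 1) = n" "a - 2 * (j + 1) = m - 2"
    by (simp_all add: n_def m_def)
  have c1: "adem_c (a - 1) b j = (if m = 0 then 0 else of_nat (nat (n + 1) choose nat (m - 1)))"
    using True m unfolding adem_c_def e by (auto simp: m_def)
  have c2: "adem_c a (b - 1) j = of_nat (nat n choose nat m)"
    using True unfolding adem_c_def e by simp
  have c3: "adem_c a b j = of_nat (nat (n + 1) choose nat m)"
    using True unfolding adem_c_def e by simp
  have c4: "adem_c a b (j + 1) = (if m < 2 then 0 else of_nat (nat n choose nat (m - 2)))"
    using True unfolding adem_c_def e by (auto simp: m_def)
  show ?thesis
    using of_nat_choose_rec[OF n, of "m - 1"] of_nat_choose_rec[OF n, of "m - 2"] m
    unfolding c1 c2 c3 c4 by (auto simp: ac_simps)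
next
  case False
  then show ?thesis using assms by (simp add: adem_c_out)
qed

lemma adem_c_step_even:
  assumes "a = 2 * b - 2" "0 \<le> j"
  shows "adem_c (a - 1) b j + (if j = b - 1 then 1 else 0) = adem_c a b j + adem_c a b (j + 1)"
proof -
  define n where "n = b - 2 - j"
  have e: "b - 1 - j = n + 1" "b - 1 - (j + 1) = n" "a - 1 - 2 * j = 2 * n + 1" "a - 2 * j = 2 * n + 2"
    "a - 2 * (j + 1) = 2 * n" "2 * j \<le> a - 1 \<longleftrightarrow> 0 \<le> n" "2 * j \<le> a \<longleftrightarrow> - 1 \<le> n"
    "2 * (j + 1) \<le> a \<longleftrightarrow> 0 \<le> n" "j = b - 1 \<longleftrightarrow> n = -1" "0 \<le> j + 1"
    using assms by (auto simp: n_def)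
  consider "n < -1" | "n = -1" | "n = 0" | "0 < n" by linarith
  then show ?thesis
    unfolding adem_c_def e using assms(2)
    by cases (simp_all add: binomial_eq_0)
qed

lemma adem_c_step_odd1:
  assumes "a = 2 * b - 1" "0 \<le> j"
  shows "adem_c a b j + adem_c a b (j + 1) = 0"
proof -
  define n where "n = b - 2 - j"
  have e: "b - 1 - j = n + 1" "b - 1 - (j + 1) = n" "a - 2 * j = 2 * n + 3"
    "a - 2 * (j + 1) = 2 * n + 1" "2 * j \<le> a \<longleftrightarrow> - 1 \<le> n"
    "2 * (j + 1) \<le> a \<longleftrightarrow> 0 \<le> n" "0 \<le> j + 1"
    using assms by (auto simp: n_def)
  consider "n < -1" | "n = -1" | "0 \<le> n" by linarith
  then show ?thesis
    unfolding adem_c_def e using assms(2)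
    by cases (simp_all add: binomial_eq_0)
qed

lemma adem_c_odd2:
  assumes "0 \<le> j"
  shows "adem_c (2 * b - 2) b j = (if j = b - 1 then 1 else 0)"
proof -
  define n where "n = b - 1 - j"
  have e: "b - 1 - j = n" "2 * b - 2 - 2 * j = 2 * n" "2 * j \<le> 2 * b - 2 \<longleftrightarrow> 0 \<le> n" "j = b - 1 \<longleftrightarrow> n = 0"
    by (auto simp: n_def)
  consider "n < 0" | "n = 0" | "0 < n" by linarith
  then show ?thesis
    unfolding adem_c_def e using assms
    by cases (simp_all add: binomial_eq_0)
qed

lemma SqSq_neg: "b < 0 \<Longrightarrow> SqSq k a b p = 0"
  by (simp add: SqSq_def SqZ_neg)

lemma sum_shift_int: "(\<Sum>j\<in>{l..m::int}. f (j - 1)) = (\<Sum>j\<in>{l-1..m-1}. f j)"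
  by (rule sum.reindex_bij_witness[of _ "\<lambda>j. j + 1" "\<lambda>j. j - 1"]) auto

lemma adem_middle:
  assumes ab: "a < 2 * b"
    and IH: "\<And>a b. a < 2 * b \<Longrightarrow> SqSq k a b p = adem_rhs k a b p"
  shows "SqSq k (a - 1) b p + SqSq k a (b - 1) p =
    (\<Sum>j\<in>{0..a}. adem_c a b j \<cdot> (SqSq k (a + b - j - 1) j p + SqSq k (a + b - j) (j - 1) p))"
    (is "_ = ?R")
proof -
  let ?S = "\<lambda>j. SqSq k (a + b - 1 - j) j p"
  consider "a < 0" | "0 \<le> a" by linarith
  then show ?thesis
  proof cases
    case 1
    then show ?thesis by (simp add: SqSq_def SqZ_neg)
  next
    case 2
    then have b: "0 < b" using ab by simp
    let ?m = "a + b"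
    have "?R = (\<Sum>j\<in>{0..?m}. adem_c a b j \<cdot> (SqSq k (a + b - j - 1) j p + SqSq k (a + b - j) (j - 1) p))"
      using b by (intro sum.mono_neutral_left) (auto simp: adem_c_def)
    also have "\<dots> = (\<Sum>j\<in>{0..?m}. adem_c a b j \<cdot> ?S j) + (\<Sum>j\<in>{0..?m}. adem_c a b (j - 1 + 1) \<cdot> ?S (j - 1))"
      by (simp add: f2_scale_add_right sum.distrib algebra_simps)
    also have "(\<Sum>j\<in>{0..?m}. adem_c a b (j - 1 + 1) \<cdot> ?S (j - 1)) = (\<Sum>j\<in>{0-1..?m - 1}. adem_c a b (j + 1) \<cdot> ?S j)"
      by (rule sum_shift_int)
    also have "\<dots> = (\<Sum>j\<in>{0..?m}. adem_c a b (j + 1) \<cdot> ?S j)"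
      using b by (intro sum.mono_neutral_cong) (auto simp: SqSq_neg adem_c_def)
    finally have R: "?R = (\<Sum>j\<in>{0..?m}. (adem_c a b j + adem_c a b (j + 1)) \<cdot> ?S j)"
      by (simp only: f2_scale_add_left sum.distrib)
    have delta: "(\<Sum>j\<in>{0..?m}. (if j = b - 1 then 1 else 0) \<cdot> ?S j) = SqSq k a (b - 1) p"
    proof -
      have "(\<Sum>j\<in>{0..?m}. (if j = b - 1 then 1 else 0) \<cdot> ?S j) = (\<Sum>j\<in>{b - 1}. ?S j)"
        using b 2 by (intro sum.mono_neutral_cong_right) auto
      then show ?thesis by simp
    qed
    have left: "SqSq k (a - 1) b p = (\<Sum>j\<in>{0..?m}. adem_c (a - 1) b j \<cdot> ?S j)"
    proof -
      have "SqSq k (a - 1) b p = adem_rhs k (a - 1) b p" using ab by (intro IH) simp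
      also have "\<dots> = (\<Sum>j\<in>{0..?m}. adem_c (a - 1) b j \<cdot> SqSq k (a - 1 + b - j) j p)"
        using b by (intro adem_rhs_alt) simp_all
      also have "\<dots> = (\<Sum>j\<in>{0..?m}. adem_c (a - 1) b j \<cdot> ?S j)"
        by (simp add: algebra_simps)
      finally show ?thesis .
    qed
    consider "a < 2 * b - 2" | "a = 2 * b - 2" | "a = 2 * b - 1" using ab by linarith
    then show ?thesis
    proof cases
      case 1
      have "SqSq k a (b - 1) p = adem_rhs k a (b - 1) p" using 1 by (intro IH) simp
      also have "\<dots> = (\<Sum>j\<in>{0..?m}. adem_c a (b - 1) j \<cdot> SqSq k (a + (b - 1) - j) j p)"
        using b by (intro adem_rhs_alt) simp_all
      also have "\<dots> = (\<Sum>j\<in>{0..?m}. adem_c a (b - 1) j \<cdot> ?S j)"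
        by (simp add: algebra_simps)
      finally have "SqSq k (a - 1) b p + SqSq k a (b - 1) p =
          (\<Sum>j\<in>{0..?m}. (adem_c (a - 1) b j + adem_c a (b - 1) j) \<cdot> ?S j)"
        unfolding left by (simp only: f2_scale_add_left sum.distrib)
      also have "\<dots> = ?R"
        unfolding R using 1 by (intro sum.cong) (simp_all only: adem_c_step atLeastAtMost_iff)
      finally show ?thesis .
    next
      case 2
      have "SqSq k (a - 1) b p + SqSq k a (b - 1) p =
          (\<Sum>j\<in>{0..?m}. (adem_c (a - 1) b j + (if j = b - 1 then 1 else 0)) \<cdot> ?S j)"
        unfolding left delta[symmetric] by (simp only: f2_scale_add_left sum.distrib)
      also have "\<dots> = ?R"
        unfolding R using 2 by (intro sum.cong) (simp_all only: adem_c_step_even atLeastAtMost_iff)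
      finally show ?thesis .
    next
      case 3
      have "SqSq k (a - 1) b p = (\<Sum>j\<in>{0..?m}. (if j = b - 1 then 1 else 0) \<cdot> ?S j)"
        unfolding left
      proof (rule sum.cong)
        fix j assume "j \<in> {0..?m}"
        then have "adem_c (a - 1) b j = (if j = b - 1 then 1 else 0)"
          using adem_c_odd2[of j b] 3 by simp
        then show "adem_c (a - 1) b j \<cdot> ?S j = (if j = b - 1 then 1 else 0) \<cdot> ?S j" by (simp only:)
      qed simp
      then have "SqSq k (a - 1) b p + SqSq k a (b - 1) p = 0"
        unfolding delta by simp
      moreover have "?R = 0"
        unfolding R
      proof (intro sum.neutral ballI)
        fix j assume "j \<in> {0..?m}"
        then have "adem_c a b j + adem_c a b (j + 1) = 0"
          by (intro adem_c_step_odd1[OF 3]) simp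
        then show "(adem_c a b j + adem_c a b (j + 1)) \<cdot> ?S j = 0"
          by (simp only: f2_scale_simps)
      qed
      ultimately show ?thesis by simp
    qed
  qed
qed

lemma adem_SqZ_one: "SqZ k r 1 = (if r = 0 then 1 else 0)"
proof (cases "r \<le> 0")
  case False
  then have "nat r = Suc (nat (r - 1))" by simp
  with False Sq_one[of k "nat (r - 1)"] show ?thesis by (simp add: SqZ_def)
qed (auto simp: SqZ_def Sq_0)

lemma adem_xpow: "a < 2 * b \<Longrightarrow> SqSq k a b (xpow e) = adem_rhs k a b (xpow e)"
proof (induction "\<Sum>i\<in>Poly_Mapping.keys e. Poly_Mapping.lookup e i" arbitrary: e a b)
  case 0
  then have "e = 0" by (intro poly_mapping_eqI) (auto simp: in_keys_iff)
  then have e: "xpow e = 1" by (simp add: xpow_def)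
  show ?case
  proof (cases "a \<le> 0")
    case True
    then show ?thesis
      unfolding e adem_rhs_def SqSq_def adem_c_def
      by (cases "a = 0") (auto simp: SqZ_def Sq_0)
  next
    case False
    then have b: "0 < b" using 0 by simp
    have "SqSq k (a + b - j) j 1 = 0" if "0 \<le> j" for j
      using False b that by (simp add: SqSq_def adem_SqZ_one)
    then have "adem_rhs k a b 1 = 0"
      unfolding adem_rhs_def by (intro sum.neutral) simp
    moreover have "SqSq k a b 1 = 0"
      using b by (simp add: SqSq_def adem_SqZ_one)
    ultimately show ?thesis unfolding e by simp
  qed
next
  case (Suc n)
  then obtain i where i: "i \<in> Poly_Mapping.keys e"
    by (metis sum.empty nat.distinct(1) equals0I)
  define f where "f = e - Poly_Mapping.single i (Suc 0)"
  have e: "e = Poly_Mapping.single i (Suc 0) + f"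
    using i by (intro poly_mapping_eqI)
      (auto simp: f_def lookup_add lookup_minus lookup_single when_def in_keys_iff)
  have n: "n = (\<Sum>i\<in>Poly_Mapping.keys f. Poly_Mapping.lookup f i)"
  proof -
    have sub: "Poly_Mapping.keys f \<subseteq> Poly_Mapping.keys e"
      by (auto simp: f_def lookup_minus in_keys_iff)
    have "Suc n = (\<Sum>j\<in>Poly_Mapping.keys e. Poly_Mapping.lookup (Poly_Mapping.single i (Suc 0)) j + Poly_Mapping.lookup f j)"
      unfolding Suc.hyps(2)
    proof (rule sum.cong)
      show "Poly_Mapping.lookup e j =
          Poly_Mapping.lookup (Poly_Mapping.single i (Suc 0)) j + Poly_Mapping.lookup f j" for j
        by (subst e) (rule lookup_add)
    qed simp
    also have "\<dots> = (\<Sum>j\<in>Poly_Mapping.keys e. Poly_Mapping.lookup (Poly_Mapping.single i (Suc 0)) j)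
        + (\<Sum>j\<in>Poly_Mapping.keys e. Poly_Mapping.lookup f j)"
      by (rule sum.distrib)
    also have "(\<Sum>j\<in>Poly_Mapping.keys e. Poly_Mapping.lookup (Poly_Mapping.single i (Suc 0)) j) =
        (\<Sum>j\<in>{i}. Poly_Mapping.lookup (Poly_Mapping.single i (Suc 0)) j)"
      using i by (intro sum.mono_neutral_right) (auto simp: lookup_single_not_eq)
    also have "(\<Sum>j\<in>Poly_Mapping.keys e. Poly_Mapping.lookup f j) = (\<Sum>j\<in>Poly_Mapping.keys f. Poly_Mapping.lookup f j)"
      using sub by (intro sum.mono_neutral_right) (auto simp: in_keys_iff)
    finally show ?thesis by simp
  qed
  have IH: "SqSq k a b (xpow f) = adem_rhs k a b (xpow f)" if "a < 2 * b" for a b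
    using Suc.hyps(1)[OF n that] .
  have ef: "xpow e = var i * xpow f"
    by (simp only: xpow_mult flip: e)
  show ?case
  proof (cases "i < k")
    case False
    then show ?thesis
      unfolding ef adem_rhs_def
      by (simp only: SqSq_const IH[OF Suc.prems] adem_rhs_def sum_distrib_left mult_f2_scale not_False_eq_True)
  next
    case True
    have top: "SqSq k (a - 2) (b - 1) (xpow f) =
        (\<Sum>j\<in>{0..a}. adem_c a b j \<cdot> SqSq k (a + b - j - 2) (j - 1) (xpow f))"
    proof -
      let ?g = "\<lambda>j. adem_c (a - 2) (b - 1) j \<cdot> SqSq k (a - 2 + (b - 1) - j) j (xpow f)"
      have "SqSq k (a - 2) (b - 1) (xpow f) = adem_rhs k (a - 2) (b - 1) (xpow f)"
        using Suc.prems by (intro IH) simp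
      also have "\<dots> = (\<Sum>j\<in>{0 - 1..a - 1}. ?g j)"
        by (rule adem_rhs_alt) simp_all
      also have "\<dots> = (\<Sum>j\<in>{0..a}. ?g (j - 1))"
        by (rule sum_shift_int[symmetric])
      also have "\<dots> = (\<Sum>j\<in>{0..a}. adem_c a b j \<cdot> SqSq k (a + b - j - 2) (j - 1) (xpow f))"
      proof (rule sum.cong)
        fix j assume j: "j \<in> {0..a}"
        show "?g (j - 1) = adem_c a b j \<cdot> SqSq k (a + b - j - 2) (j - 1) (xpow f)"
        proof (cases "j = 0")
          case True
          then show ?thesis by (simp add: SqSq_neg)
        next
          case False
          then have "adem_c (a - 2) (b - 1) (j - 1) = adem_c a b j"
            using j by (auto simp: adem_c_def algebra_simps)
          moreover have "a - 2 + (b - 1) - (j - 1) = a + b - j - 2" by simp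
          ultimately show ?thesis by (simp only:)
        qed
      qed simp
      finally show ?thesis .
    qed
    show ?thesis
      unfolding ef SqSq_var[OF True] IH[OF Suc.prems] adem_middle[OF Suc.prems IH, simplified] top adem_rhs_def
      by (simp only: f2_scale_add_right sum.distrib sum_distrib_left mult_f2_scale distrib_left)
  qed
qed

lemma adem_pol: "a < 2 * b \<Longrightarrow> SqSq k a b p = adem_rhs k a b p"
proof (induction p rule: f2_induct)
  case zero
  show ?case by (simp add: adem_rhs_def)
next
  case (add w x)
  then show ?case
    using adem_xpow[OF add.prems, of k w]
    by (simp add: xpow_def SqSq_add adem_rhs_def f2_scale_add_right sum.distrib)
qed

lemma Sq_adem:
  assumes "a < 2 * b"
  shows "Sq k a (Sq k b p) =
    (\<Sum>j\<le>a div 2. of_nat (b - 1 - j choose (a - 2 * j)) \<cdot> Sq k (a + b - j) (Sq k j p))"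
proof -
  have "Sq k a (Sq k b p) = SqSq k (int a) (int b) p"
    by (simp add: SqSq_def SqZ_def)
  also have "\<dots> = adem_rhs k (int a) (int b) p"
    using assms by (intro adem_pol) simp
  also have "\<dots> = (\<Sum>j\<in>int ` {..a div 2}. adem_c (int a) (int b) j \<cdot> SqSq k (int a + int b - j) j p)"
    unfolding adem_rhs_def
  proof (rule sum.mono_neutral_right)
    show "\<forall>j\<in>{0..int a} - int ` {..a div 2}. adem_c (int a) (int b) j \<cdot> SqSq k (int a + int b - j) j p = 0"
    proof
      fix j assume j: "j \<in> {0..int a} - int ` {..a div 2}"
      have "int a < 2 * j"
      proof (rule ccontr)
        assume "\<not> int a < 2 * j"
        then have "nat j \<le> a div 2" "j = int (nat j)" using j by auto
        then show False using j by blast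
      qed
      then show "adem_c (int a) (int b) j \<cdot> SqSq k (int a + int b - j) j p = 0"
        by (simp add: adem_c_out)
    qed
  qed auto
  also have "\<dots> = (\<Sum>j\<le>a div 2. adem_c (int a) (int b) (int j) \<cdot> SqSq k (int a + int b - int j) (int j) p)"
    by (rule sum.reindex_cong[of int]) auto
  also have "\<dots> = (\<Sum>j\<le>a div 2. of_nat (b - 1 - j choose (a - 2 * j)) \<cdot> Sq k (a + b - j) (Sq k j p))"
  proof (rule sum.cong)
    fix j assume "j \<in> {..a div 2}"
    then have j: "2 * j \<le> a" by auto
    then have 1: "nat (int b - 1 - int j) = b - 1 - j" "nat (int a - 2 * int j) = a - 2 * j"
      "nat (int a + int b - int j) = a + b - j"
      by linarith+
    have "2 * int j \<le> int a" "\<not> int a + int b - int j < 0" using j by linarith+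
    then show "adem_c (int a) (int b) (int j) \<cdot> SqSq k (int a + int b - int j) (int j) p =
        of_nat (b - 1 - j choose (a - 2 * j)) \<cdot> Sq k (a + b - j) (Sq k j p)"
      unfolding adem_c_def SqSq_def SqZ_def 1 by simp
  qed simp
  finally show ?thesis .
qed

section \<open>The mod-2 Steenrod algebra\<close>

text \<open>
  Words in the symbols $\mathrm{Sq}^0,\mathrm{Sq}^1,\dots$, written additively under
  concatenation, so that the library's convolution product makes \<open>sqword \<Rightarrow>\<^sub>0 bit\<close> the free
  associative algebra on these symbols.
\<close>

datatype sqword = Sqword (letters: "nat list")

instantiation sqword :: monoid_add
begin

definition zero_sqword :: sqword
  where "0 = Sqword []"

definition plus_sqword :: "sqword \<Rightarrow> sqword \<Rightarrow> sqword"
  where "u + v = Sqword (letters u @ letters v)"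

instance
  by standard (simp_all add: zero_sqword_def plus_sqword_def)

end

type_synonym sqfree = "sqword \<Rightarrow>\<^sub>0 bit"

definition gen :: "nat \<Rightarrow> sqfree"
  where "gen r = Poly_Mapping.single (Sqword [r]) 1"

text \<open>Used only for $0<a<2b$, where the natural-number subtractions do not truncate.\<close>

definition adem_relator :: "nat \<Rightarrow> nat \<Rightarrow> sqfree"
  where "adem_relator a b = gen a * gen b
    - (\<Sum>j\<le>a div 2. of_nat (b - 1 - j choose (a - 2 * j)) \<cdot> (gen (a + b - j) * gen j))"

text \<open>The two-sided ideal generated by $\mathrm{Sq}^0-1$ and the Adem relators.\<close>

inductive_set adem_ideal :: "sqfree set" where
  zero: "0 \<in> adem_ideal"
| add: "x \<in> adem_ideal \<Longrightarrow> y \<in> adem_ideal \<Longrightarrow> x + y \<in> adem_ideal"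
| unit: "u * (gen 0 - 1) * v \<in> adem_ideal"
| adem: "0 < a \<Longrightarrow> a < 2 * b \<Longrightarrow> u * adem_relator a b * v \<in> adem_ideal"

lemma adem_ideal_mult_left: "x \<in> adem_ideal \<Longrightarrow> y * x \<in> adem_ideal"
proof (induction rule: adem_ideal.induct)
  case (unit u v)
  then show ?case using adem_ideal.unit[of "y * u" v] by (simp only: mult.assoc)
next
  case (adem a b u v)
  then show ?case using adem_ideal.adem[of a b "y * u" v] by (simp only: mult.assoc)
qed (simp_all add: adem_ideal.zero adem_ideal.add distrib_left)

lemma adem_ideal_mult_right: "x \<in> adem_ideal \<Longrightarrow> x * y \<in> adem_ideal"
proof (induction rule: adem_ideal.induct)
  case (unit u v)
  then show ?case using adem_ideal.unit[of u "v * y"] by (simp only: mult.assoc)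
next
  case (adem a b u v)
  then show ?case using adem_ideal.adem[of a b u "v * y"] by (simp only: mult.assoc)
qed (simp_all add: adem_ideal.zero adem_ideal.add distrib_right)

subsection \<open>The action of the free algebra on polynomials\<close>

definition word_act :: "nat \<Rightarrow> sqword \<Rightarrow> pol \<Rightarrow> pol"
  where "word_act k w = foldr (Sq k) (letters w)"

definition free_act :: "nat \<Rightarrow> sqfree \<Rightarrow> pol \<Rightarrow> pol"
  where "free_act k x p = f2_ext (\<lambda>w. word_act k w p) x"

lemma word_act_plus: "word_act k (u + v) p = word_act k u (word_act k v p)"
  by (simp add: word_act_def plus_sqword_def)

lemma word_act_add: "word_act k w (p + q) = word_act k w p + word_act k w q"
proof -
  have "foldr (Sq k) rs (p + q) = foldr (Sq k) rs p + foldr (Sq k) rs q" for rs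
    by (induction rs) (simp_all add: Sq_add)
  then show ?thesis by (simp add: word_act_def)
qed

lemma word_act_zero [simp]: "word_act k w 0 = 0"
  using word_act_add[of k w 0 0] by simp

lemma free_act_zero [simp]: "free_act k 0 p = 0"
  by (simp add: free_act_def)

lemma free_act_add: "free_act k (x + y) p = free_act k x p + free_act k y p"
  by (simp add: free_act_def f2_ext_add)

lemma free_act_zero_right [simp]: "free_act k x 0 = 0"
  by (simp add: free_act_def f2_ext_def)

lemma free_act_add_right: "free_act k x (p + q) = free_act k x p + free_act k x q"
  by (simp add: free_act_def word_act_add f2_ext_add_fun)

lemma free_act_single: "free_act k (Poly_Mapping.single w 1) p = word_act k w p"
  by (simp add: free_act_def)

lemma free_act_mult: "free_act k (x * y) p = free_act k x (free_act k y p)"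
proof (induction x rule: f2_induct)
  case (add u x)
  have "free_act k (Poly_Mapping.single u 1 * y) p = word_act k u (free_act k y p)"
    by (induction y rule: f2_induct)
      (simp_all add: distrib_left free_act_add word_act_add mult_single free_act_single word_act_plus)
  with add show ?case
    by (simp add: distrib_right free_act_add free_act_single)
qed simp

lemma free_act_gen: "free_act k (gen r) p = Sq k r p"
  by (simp add: gen_def free_act_single word_act_def)

lemma free_act_one: "free_act k 1 p = p"
  unfolding single_one[symmetric] free_act_single by (simp add: word_act_def zero_sqword_def)

lemma free_act_scale: "free_act k (c \<cdot> x) p = c \<cdot> free_act k x p"
  by (cases c) simp_all

lemma free_act_sum: "free_act k (\<Sum>i\<in>A. h i) p = (\<Sum>i\<in>A. free_act k (h i) p)"
  by (induction A rule: infinite_finite_induct) (simp_all add: free_act_add)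

lemma free_act_adem_ideal: "x \<in> adem_ideal \<Longrightarrow> free_act k x p = 0"
proof (induction arbitrary: p rule: adem_ideal.induct)
  case (unit u v)
  have "free_act k (gen 0 - 1) q = 0" for q
    by (simp add: f2_minus free_act_add free_act_gen free_act_one Sq_0)
  then show ?case by (simp add: free_act_mult)
next
  case (adem a b u v)
  have "free_act k (adem_relator a b) q = 0" for q
    by (simp add: adem_relator_def f2_minus free_act_add free_act_sum free_act_scale free_act_mult
        free_act_gen Sq_adem[OF adem(2)])
  then show ?case by (simp add: free_act_mult)
qed (simp_all add: free_act_add)

lemma one_notin_adem_ideal: "1 \<notin> adem_ideal"
proof
  assume "1 \<in> adem_ideal"
  from free_act_adem_ideal[OF this, of 0 1] show False
    by (simp add: free_act_one)
qed

subsection \<open>The Steenrod algebra and its action\<close>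

quotient_type steenrod = sqfree / "\<lambda>x y. x - y \<in> adem_ideal"
proof (rule equivpI)
  show "reflp (\<lambda>x y. x - y \<in> adem_ideal)"
    by (simp add: reflp_def adem_ideal.zero)
  show "symp (\<lambda>x y. x - y \<in> adem_ideal)"
    by (simp add: symp_def f2_minus add.commute)
  show "transp (\<lambda>x y. x - y \<in> adem_ideal)"
  proof (rule transpI)
    fix x y z :: sqfree
    assume "x - y \<in> adem_ideal" "y - z \<in> adem_ideal"
    from adem_ideal.add[OF this] show "x - z \<in> adem_ideal"
      by (simp only: add_diff_eq diff_add_cancel)
  qed
qed

instantiation steenrod :: ring_1
begin

lift_definition zero_steenrod :: steenrod is 0 .

lift_definition one_steenrod :: steenrod is 1 .

lift_definition plus_steenrod :: "steenrod \<Rightarrow> steenrod \<Rightarrow> steenrod" is "(+)"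
proof -
  fix x x' y y' :: sqfree
  assume "x - x' \<in> adem_ideal" "y - y' \<in> adem_ideal"
  from adem_ideal.add[OF this] show "x + y - (x' + y') \<in> adem_ideal"
    by (simp add: algebra_simps)
qed

lift_definition uminus_steenrod :: "steenrod \<Rightarrow> steenrod" is uminus
  by (simp add: f2_minus)

lift_definition minus_steenrod :: "steenrod \<Rightarrow> steenrod \<Rightarrow> steenrod" is "(-)"
proof -
  fix x x' y y' :: sqfree
  assume "x - x' \<in> adem_ideal" "y - y' \<in> adem_ideal"
  from adem_ideal.add[OF this] show "x - y - (x' - y') \<in> adem_ideal"
    by (simp add: f2_minus ac_simps)
qed

lift_definition times_steenrod :: "steenrod \<Rightarrow> steenrod \<Rightarrow> steenrod" is "(*)"
proof -
  fix x x' y y' :: sqfree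
  assume "x - x' \<in> adem_ideal" "y - y' \<in> adem_ideal"
  then have "(x - x') * y + x' * (y - y') \<in> adem_ideal"
    by (intro adem_ideal.add adem_ideal_mult_left adem_ideal_mult_right)
  then show "x * y - x' * y' \<in> adem_ideal"
    by (simp only: left_diff_distrib right_diff_distrib add_diff_eq diff_add_cancel)
qed

instance
proof
  show "(0 :: steenrod) \<noteq> 1"
    by transfer (simp add: f2_minus one_notin_adem_ideal)
qed (transfer, simp add: adem_ideal.zero algebra_simps)+

end

instance steenrod :: f2_space
  by standard (transfer, simp add: adem_ideal.zero)

text \<open>The class of $\mathrm{Sq}^r$ in the Steenrod algebra.\<close>

lift_definition St :: "nat \<Rightarrow> steenrod" is gen .

text \<open>The homogeneous elements of degree $n$; zero is included.\<close>

definition steenrod_deg :: "nat \<Rightarrow> steenrod set"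
  where "steenrod_deg n = abs_steenrod ` {x. \<forall>w\<in>Poly_Mapping.keys x. sum_list (letters w) = n}"

lift_definition act :: "nat \<Rightarrow> steenrod \<Rightarrow> pol \<Rightarrow> pol" is free_act
proof (rule ext)
  fix k :: nat and x y :: sqfree and p :: pol
  assume "x - y \<in> adem_ideal"
  from free_act_adem_ideal[OF this, of k p] have "free_act k x p + free_act k y p = 0"
    by (simp add: f2_minus free_act_add)
  then show "free_act k x p = free_act k y p"
    by (simp add: add_eq_0_iff)
qed

lemma act_St: "act k (St r) p = Sq k r p"
  by transfer (rule free_act_gen)

lemma act_one: "act k 1 p = p"
  by transfer (rule free_act_one)

lemma act_mult: "act k (\<theta> * \<eta>) p = act k \<theta> (act k \<eta> p)"
  by transfer (rule free_act_mult)

lemma act_add_left: "act k (\<theta> + \<eta>) p = act k \<theta> p + act k \<eta> p"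
  by transfer (rule free_act_add)

lemma act_add_right: "act k \<theta> (p + q) = act k \<theta> p + act k \<theta> q"
  by transfer (rule free_act_add_right)

section \<open>The hit matrix\<close>

text \<open>
  A tuple $(g_t)_t$ is an element of \<^typ>\<open>nat \<Rightarrow>\<^sub>0 pol\<close>; $V(k,d)$ is the subspace with
  monomial basis the tuples \<open>label_vec l\<close>, for \<open>l\<close> in \<open>labels k d\<close>.
\<close>

type_synonym tuple = "nat \<Rightarrow>\<^sub>0 pol"

definition labels :: "nat \<Rightarrow> nat \<Rightarrow> (nat \<times> expo) set"
  where "labels k d = (SIGMA t:{t. 2 ^ t \<le> d}. expos k (d - 2 ^ t))"

definition label_vec :: "nat \<times> expo \<Rightarrow> tuple"
  where "label_vec l = Poly_Mapping.single (fst l) (xpow (snd l))"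

definition hit_map :: "nat \<Rightarrow> tuple \<Rightarrow> pol"
  where "hit_map k v = (\<Sum>t\<in>Poly_Mapping.keys v. Sq k (2 ^ t) (Poly_Mapping.lookup v t))"

text \<open>
  The rank does not depend on how rows and columns are ordered; the library's linear order on
  \<^typ>\<open>expo\<close> is used for the monomials of a given degree.
\<close>

definition hit_rows :: "nat \<Rightarrow> nat \<Rightarrow> expo list"
  where "hit_rows k d = sorted_list_of_set (expos k d)"

definition hit_cols :: "nat \<Rightarrow> nat \<Rightarrow> (nat \<times> expo) list"
  where "hit_cols k d = [(t, g). t \<leftarrow> [0..<d], 2 ^ t \<le> d, g \<leftarrow> hit_rows k (d - 2 ^ t)]"

definition hit_matrix :: "nat \<Rightarrow> nat \<Rightarrow> bit mat"
  where "hit_matrix k d = mat (length (hit_rows k d)) (length (hit_cols k d))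
    (\<lambda>(i, j). Poly_Mapping.lookup (hit_map k (label_vec (hit_cols k d ! j))) (hit_rows k d ! i))"

text \<open>
  The library's rank, the dimension of the column span; its first argument is the dimension of
  the ambient coordinate space.
\<close>

definition mat_rank :: "'a::field mat \<Rightarrow> nat"
  where "mat_rank A = vec_space.rank (dim_row A) A"

lemma level_less: "2 ^ t \<le> d \<Longrightarrow> t < (d::nat)"
  using less_exp by (rule less_le_trans)

lemma finite_levels: "finite {t::nat. 2 ^ t \<le> (d::nat)}"
  by (rule finite_subset[of _ "{..<d}"]) (auto simp: level_less)

lemma set_hit_rows: "set (hit_rows k d) = expos k d" and distinct_hit_rows: "distinct (hit_rows k d)"
  by (simp_all add: hit_rows_def)

lemma set_hit_cols: "set (hit_cols k d) = labels k d"
  by (force simp: hit_cols_def labels_def set_hit_rows level_less)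

section \<open>Counts\<close>

text \<open>
  All degrees below are natural numbers: the arguments $d-2^t$ and $d-1$ occur only where they
  are nonnegative. Differences of counts are taken in \<^typ>\<open>int\<close>.
\<close>

definition Pdim :: "nat \<Rightarrow> nat \<Rightarrow> nat"
  where "Pdim k n = F2.dim (Pol k n)"

definition rho :: "nat \<Rightarrow> nat \<Rightarrow> nat"
  where "rho k n = F2.dim (Sq k 1 ` Pol k n)"

definition zeros :: "nat \<Rightarrow> nat \<Rightarrow> nat \<Rightarrow> nat"
  where "zeros t k S = card {g \<in> expos k S. Sq k (2 ^ t) (xpow g) = 0}"

definition W :: "nat \<Rightarrow> nat \<Rightarrow> int"
  where "W k d = (\<Sum>t | 2 ^ t \<le> d. int (Pdim k (d - 2 ^ t)) - int (zeros t k (d - 2 ^ t)))"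

definition W1 :: "nat \<Rightarrow> nat \<Rightarrow> int"
  where "W1 k d = (if d = 0 then 0 else int (rho k (d - 1)) +
    (\<Sum>t | 1 \<le> t \<and> 2 ^ t \<le> d. int (Pdim k (d - 2 ^ t)) - int (zeros t k (d - 2 ^ t))))"

section \<open>Relations\<close>

text \<open>
  A relation is kept together with its degree, which is not determined by the zero tuple. A
  nonzero entry of negative degree is impossible, hence the condition \<open>2 ^ t \<le> a\<close>.
\<close>

type_synonym relation = "nat \<times> (nat \<Rightarrow>\<^sub>0 steenrod)"

definition homogeneous_relation :: "relation \<Rightarrow> bool"
  where "homogeneous_relation = (\<lambda>(a, \<Theta>). 0 < a \<and>
    (\<forall>t\<in>Poly_Mapping.keys \<Theta>. 2 ^ t \<le> a \<and> Poly_Mapping.lookup \<Theta> t \<in> steenrod_deg (a - 2 ^ t)) \<and>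
    (\<Sum>t\<in>Poly_Mapping.keys \<Theta>. St (2 ^ t) * Poly_Mapping.lookup \<Theta> t) = 0)"

definition rel_map :: "nat \<Rightarrow> (nat \<Rightarrow>\<^sub>0 steenrod) \<Rightarrow> pol \<Rightarrow> tuple"
  where "rel_map k \<Theta> f = Poly_Mapping.map (\<lambda>\<theta>. act k \<theta> f) \<Theta>"

definition rel_image :: "nat \<Rightarrow> nat \<Rightarrow> relation \<Rightarrow> tuple set"
  where "rel_image k d = (\<lambda>(a, \<Theta>). if a \<le> d then rel_map k \<Theta> ` Pol k (d - a) else {0})"

text \<open>Sums of subspaces are sums of sets in the sense of \<^theory>\<open>HOL-Library.Set_Algebras\<close>.\<close>

definition KR :: "nat \<Rightarrow> nat \<Rightarrow> relation set \<Rightarrow> tuple set"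
  where "KR k d R = (\<Sum>r\<in>R. rel_image k d r)"

definition E0 :: "nat \<Rightarrow> nat \<Rightarrow> tuple set"
  where "E0 k d = F2.span (label_vec ` {(t, g) \<in> labels k d. Sq k (2 ^ t) (xpow g) = 0})"

definition Delta :: "nat \<Rightarrow> nat \<Rightarrow> relation set \<Rightarrow> int"
  where "Delta k d R = int (F2.dim (E0 k d + KR k d R)) - int (F2.dim (E0 k d))"

definition Theta1 :: relation
  where "Theta1 = (2, Poly_Mapping.single 0 (St 1))"

definition F1 :: "nat \<Rightarrow> nat \<Rightarrow> tuple set"
  where "F1 k d = E0 k d + rel_image k d Theta1"

definition delta1 :: "nat \<Rightarrow> nat \<Rightarrow> relation set \<Rightarrow> int"
  where "delta1 k d R = int (F2.dim (F1 k d + KR k d R)) - int (F2.dim (F1 k d))"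

lemma homogeneous_Theta1: "homogeneous_relation Theta1"
proof -
  have "St 1 * St 1 = 0"
    using adem_ideal.adem[of 1 1 1 1]
    by transfer (simp add: adem_relator_def)
  moreover have "St 1 \<in> steenrod_deg 1"
    unfolding steenrod_deg_def St.abs_eq
    by (rule imageI) (simp add: gen_def)
  ultimately show ?thesis
    by (simp add: homogeneous_relation_def Theta1_def)
qed

end

theory Submission
  imports Defs
begin

text \<open>
  Put $V = V(k,d)$ and $\Phi = \Phi_{k,d}$. Zero columns and relations both produce elements of
  $\ker\Phi$: a label \<open>(t, g)\<close> with $\mathrm{Sq}^{2^t}(g) = 0$ does so by definition, and a relation
  $\sum_t \mathrm{Sq}^{2^t}\Theta_t = 0$ gives
  $\Phi((\Theta_t f)_t) = (\sum_t \mathrm{Sq}^{2^t}\Theta_t) f = 0$ because the Steenrod algebra acts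
  on polynomials. Hence $F_1 + K_{\mathscr R} \subseteq \ker\Phi$, and by rank and nullity
  \[ \operatorname{rank} M(k,d) \le \dim V - \dim(F_1 + K_{\mathscr R})
     = (\dim V - \dim F_1) - \delta^{(1)}_{\mathscr R}. \]

  The two counts are codimensions in $V$, which turns all the inequalities into monotonicity of the
  dimension. That $\mathcal W_k(d) = \dim V - \dim E_0$ is a count of labels (\<open>W_eq\<close>). That
  $\mathcal W^{(1)}_k(d) = \dim V - \dim F_1$ (\<open>W1_eq\<close>) is the substantial point. In the component
  $t = 0$ it requires that the monomials killed by $\mathrm{Sq}^1$, together with the image of
  $\mathrm{Sq}^1$, span all of $\ker \mathrm{Sq}^1$ in degree $d - 1$; only then is the codimension of
  that component equal to $\rho_k(d-1)$. In positive degrees the complex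
  $(\mathcal P_k, \mathrm{Sq}^1)$ is exact (\<open>Sq1_exact\<close>), so the image alone suffices, and in
  degree $0$ the kernel is spanned by the monomial $1$.

  Granted this, the remaining inequality
  $\mathcal W^{(1)}_k(d) - \delta^{(1)}_{\mathscr R} \le \mathcal W_k(d) - \Delta_{\mathscr R}$ reads
  $\dim(E_0 + K_{\mathscr R}) \le \dim(F_1 + K_{\mathscr R})$, which holds since $E_0 \subseteq F_1$.

  All the subspaces are finite sets, so their dimensions are obtained by counting elements: a
  subspace of dimension $n$ has $2^n$ of them (\<open>card_subspace\<close>).
\<close>

section \<open>Counting in finite vector spaces over the field with two elements\<close>

lemma f2_subspaceI:
  fixes S :: "'a::f2_space set"
  assumes "0 \<in> S" "\<And>x y. x \<in> S \<Longrightarrow> y \<in> S \<Longrightarrow> x + y \<in> S"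
  shows "F2.subspace S"
  using assms by (intro F2.subspaceI) (auto simp: f2_scale_def)

text \<open>
  The only scalars are $0$ and $1$, so a new generator adds one translate of the old span. If it
  lies outside the old span the translate is disjoint from it, which is why each basis vector
  doubles the number of elements below.
\<close>

lemma f2_span_insert: "F2.span (insert b B) = F2.span B \<union> (+) b ` F2.span (B :: 'a::f2_space set)"
proof -
  have "x \<in> F2.span (insert b B) \<longleftrightarrow> x \<in> F2.span B \<or> b + x \<in> F2.span B" for x
    unfolding F2.span_breakdown_eq
    by (auto simp: f2_scale_def f2_minus add.commute exI[of _ "0::bit"] exI[of _ "1::bit"])
  moreover have "x \<in> (+) b ` F2.span B \<longleftrightarrow> b + x \<in> F2.span B" for x
    by (auto intro: image_eqI[of _ _ "b + x"])
  ultimately show ?thesis by blast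
qed

lemma card_span_independent:
  fixes B :: "'a::f2_space set"
  assumes "finite B" "F2.independent B"
  shows "finite (F2.span B) \<and> card (F2.span B) = 2 ^ card B"
  using assms
proof (induction B rule: finite_induct)
  case (insert b B)
  then have b: "b \<notin> F2.span B" and B: "F2.independent B"
    by (auto simp: F2.independent_insert)
  have "F2.span B \<inter> (+) b ` F2.span B = {}"
    using b F2.span_add_eq2[of _ B b] by fastforce
  with insert.IH[OF B] insert.hyps show ?case
    by (simp add: f2_span_insert card_Un_disjoint card_image)
qed simp

text \<open>
  This reduces statements about dimensions to statements about cardinalities. The ambient types
  have infinite dimension, so dimensions are controlled through finiteness of the subspaces.
\<close>

lemma card_subspace:
  fixes S :: "'a::f2_space set"
  assumes "F2.subspace S" "finite S"
  shows "card S = 2 ^ F2.dim S"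
proof -
  obtain B where B: "B \<subseteq> S" "F2.independent B" "S \<subseteq> F2.span B" "card B = F2.dim S"
    using F2.basis_exists .
  then have "S = F2.span B"
    using assms(1) by (simp add: F2.span_minimal subset_antisym)
  moreover have "finite B"
    using B(1) assms(2) by (rule finite_subset)
  ultimately show ?thesis
    using card_span_independent[of B] B by simp
qed

lemma f2_dim_mono:
  fixes S T :: "'a::f2_space set"
  assumes "F2.subspace S" "F2.subspace T" "finite T" "S \<subseteq> T"
  shows "F2.dim S \<le> F2.dim T"
proof -
  have "(2::nat) ^ F2.dim S \<le> 2 ^ F2.dim T"
    using card_mono[OF assms(3,4)] assms card_subspace[of S] card_subspace[of T]
    by (simp add: finite_subset)
  then show ?thesis by simp
qed

lemma f2_subspace_image:
  fixes f :: "'a::f2_space \<Rightarrow> 'b::f2_space"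
  assumes add: "\<And>x y. f (x + y) = f x + f y" and V: "F2.subspace V"
  shows "F2.subspace (f ` V)"
proof (rule f2_subspaceI)
  have "f 0 = 0"
    using add[of 0 0] by simp
  then show "0 \<in> f ` V"
    using F2.subspace_0[OF V] by force
  show "x + y \<in> f ` V" if "x \<in> f ` V" "y \<in> f ` V" for x y
    using that add[symmetric] F2.subspace_add[OF V] by (auto simp: image_iff)
qed

lemma f2_subspace_vimage:
  fixes f :: "'a::f2_space \<Rightarrow> 'b::f2_space"
  assumes add: "\<And>x y. f (x + y) = f x + f y" and U: "F2.subspace U"
  shows "F2.subspace {x. f x \<in> U}"
proof (rule f2_subspaceI)
  have "f 0 = 0"
    using add[of 0 0] by simp
  then show "0 \<in> {x. f x \<in> U}"
    using F2.subspace_0[OF U] by simp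
qed (auto simp: add F2.subspace_add[OF U])

text \<open>
  Every nonempty fibre of an additive map is a translate of its kernel. Over the field with two
  elements additivity already is linearity.
\<close>

lemma f2_rank_nullity:
  fixes f :: "'a::f2_space \<Rightarrow> 'b::f2_space"
  assumes add: "\<And>x y. f (x + y) = f x + f y" and V: "F2.subspace V" and fin: "finite V"
  shows "F2.dim V = F2.dim {v \<in> V. f v = 0} + F2.dim (f ` V)"
proof -
  let ?K = "{v \<in> V. f v = 0}"
  have K: "F2.subspace ?K"
    using F2.subspace_inter[OF V f2_subspace_vimage[of f "{0}", OF add]]
    by (simp add: Int_def)
  have "card {v \<in> V. f v = y} = card ?K" if "y \<in> f ` V" for y
  proof -
    from that obtain w where w: "w \<in> V" "f w = y" by blast
    have "bij_betw ((+) w) ?K {v \<in> V. f v = y}"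
      by (rule bij_betw_byWitness[where f' = "(+) w"])
        (use w F2.subspace_add[OF V] in \<open>auto simp: add\<close>)
    then show ?thesis by (rule bij_betw_same_card[symmetric])
  qed
  then have "card V = card (f ` V) * card ?K"
    using card_eq_sum[of V] sum.group[OF fin finite_imageI[OF fin] order_refl, of "\<lambda>_. 1::nat" f]
    by simp
  then have "(2::nat) ^ F2.dim V = 2 ^ (F2.dim ?K + F2.dim (f ` V))"
    using card_subspace[OF V fin] card_subspace[OF K] fin
      card_subspace[OF f2_subspace_image[of f, OF add V]]
    by (simp add: power_add mult.commute)
  then show ?thesis by simp
qed

lemma f2_dim_inj_image:
  fixes f :: "'a::f2_space \<Rightarrow> 'b::f2_space"
  assumes add: "\<And>x y. f (x + y) = f x + f y" and "inj_on f V" and V: "F2.subspace V" and "finite V"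
  shows "F2.dim (f ` V) = F2.dim V"
proof -
  have "(2::nat) ^ F2.dim (f ` V) = 2 ^ F2.dim V"
    using card_subspace[OF V] card_subspace[OF f2_subspace_image[of f, OF add V]] assms
    by (simp add: card_image)
  then show ?thesis by simp
qed

lemma f2_subspace_plus:
  fixes S T :: "'a::f2_space set"
  assumes "F2.subspace S" "F2.subspace T"
  shows "F2.subspace (S + T)"
  using F2.subspace_sums[OF assms] by (simp add: set_plus_def Bex_def conj_ac cong: conj_cong)

lemma subset_plus_left: "F2.subspace T \<Longrightarrow> S \<subseteq> S + (T :: 'a::f2_space set)"
  using set_plus_intro[of _ S 0 T] F2.subspace_0[of T] by auto

lemma subset_plus_right: "F2.subspace S \<Longrightarrow> T \<subseteq> S + (T :: 'a::f2_space set)"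
  using subset_plus_left[of S T] by (simp add: add.commute)

lemma plus_subset_subspace:
  "F2.subspace U \<Longrightarrow> S \<subseteq> U \<Longrightarrow> T \<subseteq> U \<Longrightarrow> S + T \<subseteq> (U :: 'a::f2_space set)"
  by (auto elim!: set_plus_elim intro: F2.subspace_add)

lemma f2_dim_direct_sum:
  fixes S T :: "'a::f2_space set"
  assumes S: "F2.subspace S" "finite S" and T: "F2.subspace T" "finite T" and ST: "S \<inter> T \<subseteq> {0}"
  shows "F2.dim (S + T) = F2.dim S + F2.dim T"
proof -
  have eq: "S + T = (\<lambda>(x, y). x + y) ` (S \<times> T)"
    by (auto simp: set_plus_def)
  have "inj_on (\<lambda>(x, y). x + y) (S \<times> T)"
  proof (rule inj_onI, clarify)
    fix x y x' y'
    assume mem: "x \<in> S" "y \<in> T" "x' \<in> S" "y' \<in> T" and eq: "x + y = x' + y'"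
    from eq have diff: "x + x' = y + y'"
      by (metis add.left_commute f2_add_self_left add.commute)
    then have "x + x' \<in> S \<inter> T"
      using F2.subspace_add[OF S(1)] F2.subspace_add[OF T(1)] mem by (metis IntI)
    with ST have "x + x' = 0" by blast
    with diff show "x = x' \<and> y = y'"
      by (metis add_eq_0_iff f2_uminus)
  qed
  then have "card (S + T) = card S * card T"
    by (simp add: eq card_image card_cartesian_product)
  moreover have "finite (S + T)"
    using S T by (simp add: eq)
  ultimately have "(2::nat) ^ F2.dim (S + T) = 2 ^ (F2.dim S + F2.dim T)"
    using card_subspace[OF f2_subspace_plus[OF S(1) T(1)]] card_subspace[OF S] card_subspace[OF T]
    by (simp add: power_add)
  then show ?thesis by simp
qed

lemma f2_subspace_sum:
  fixes S :: "'i \<Rightarrow> 'a::f2_space set"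
  shows "(\<And>i. i \<in> I \<Longrightarrow> F2.subspace (S i)) \<Longrightarrow> F2.subspace (\<Sum>i\<in>I. S i)"
  by (induction I rule: infinite_finite_induct) (auto simp: set_zero intro: f2_subspace_plus)

lemma sum_subset_subspace:
  fixes S :: "'i \<Rightarrow> 'a::f2_space set"
  assumes U: "F2.subspace U"
  shows "(\<And>i. i \<in> I \<Longrightarrow> S i \<subseteq> U) \<Longrightarrow> (\<Sum>i\<in>I. S i) \<subseteq> U"
proof (induction I rule: infinite_finite_induct)
  case (insert i I)
  then show ?case
    using plus_subset_subspace[OF U, of "S i" "\<Sum>i\<in>I. S i"] by simp
qed (simp_all add: set_zero F2.subspace_0[OF U])

text \<open>
  A linear combination over the field with two elements is the sum of a subset.
\<close>

lemma f2_independentI: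
  fixes B :: "'a::f2_space set"
  assumes "\<And>T. finite T \<Longrightarrow> T \<subseteq> B \<Longrightarrow> T \<noteq> {} \<Longrightarrow> \<Sum>T \<noteq> 0"
  shows "F2.independent B"
  unfolding F2.dependent_explicit
proof clarify
  fix t :: "'a set" and u :: "'a \<Rightarrow> bit" and v
  assume t: "finite t" "t \<subseteq> B" "(\<Sum>v\<in>t. u v \<cdot> v) = 0" "v \<in> t" "u v \<noteq> 0"
  have "\<Sum>{w \<in> t. u w \<noteq> 0} = (\<Sum>v\<in>t. u v \<cdot> v)"
    using t(1) by (intro sum.mono_neutral_cong_left) (auto simp: f2_scale_def)
  with t assms[of "{w \<in> t. u w \<noteq> 0}"] show False by auto
qed

section \<open>Homogeneous polynomials and the squares\<close>

lemma independent_monomials: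
  "F2.independent ((\<lambda>x. Poly_Mapping.single x (1 :: bit)) ` A)" (is "F2.independent (?m ` A)")
proof (rule f2_independentI)
  fix T assume T: "finite T" "T \<subseteq> ?m ` A" "T \<noteq> {}"
  then obtain L where L: "finite L" "T = ?m ` L"
    by (metis finite_subset_image)
  have inj: "inj_on ?m L"
    by (auto intro!: inj_onI dest: arg_cong[where f = Poly_Mapping.keys])
  from L T obtain x where x: "x \<in> L" by auto
  have "Poly_Mapping.lookup (\<Sum>T) x = (\<Sum>y\<in>L. if y = x then 1 else 0)"
    by (simp add: L(2) sum.reindex[OF inj] lookup_sum lookup_single when_def)
  also have "\<dots> = 1"
    using x L(1) by simp
  finally show "\<Sum>T \<noteq> 0" by auto
qed

lemma Pol_span: "Pol k n = F2.span (xpow ` expos k n)"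
proof
  show "Pol k n \<subseteq> F2.span (xpow ` expos k n)"
  proof
    fix p assume p: "p \<in> Pol k n"
    have "(\<Sum>e\<in>Poly_Mapping.keys p. xpow e) \<in> F2.span (xpow ` expos k n)"
      using p by (intro F2.span_sum F2.span_base) (auto simp: Pol_def)
    then show "p \<in> F2.span (xpow ` expos k n)"
      using f2_expand[of p] by (simp add: f2_ext_def xpow_def)
  qed
  have "F2.subspace (Pol k n)"
    by (rule f2_subspaceI) (use keys_add in \<open>fastforce simp: Pol_def\<close>)+
  then show "F2.span (xpow ` expos k n) \<subseteq> Pol k n"
    by (rule F2.span_minimal[rotated]) (auto simp: Pol_def xpow_def)
qed

lemma subspace_Pol: "F2.subspace (Pol k n)"
  by (simp add: Pol_span)

lemma finite_Pol: "finite (Pol k n)" and Pdim_eq: "Pdim k n = card (expos k n)"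
proof -
  have ind: "F2.independent (xpow ` expos k n)"
    using independent_monomials[of "expos k n"] by (simp add: xpow_def[abs_def])
  show "finite (Pol k n)"
    using card_span_independent[OF finite_imageI[OF finite_expos] ind] by (simp add: Pol_span)
  have "inj xpow"
    by (auto intro!: injI simp: xpow_def dest: arg_cong[where f = Poly_Mapping.keys])
  then show "Pdim k n = card (expos k n)"
    by (simp add: Pdim_def Pol_span F2.dim_eq_card_independent[OF ind] card_image inj_on_subset)
qed

text \<open>
  The principle by which linear statements about homogeneous polynomials are reduced to monomials:
  the polynomials satisfying the statement form a subspace.
\<close>

lemma Pol_subsetI:
  assumes "F2.subspace U" "\<And>e. e \<in> expos k n \<Longrightarrow> xpow e \<in> U"
  shows "Pol k n \<subseteq> U"
  unfolding Pol_span using assms by (intro F2.span_minimal) auto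

lemma expos_add: "a \<in> expos k n \<Longrightarrow> b \<in> expos k r \<Longrightarrow> a + b \<in> expos k (n + r)"
  using keys_add[of a b] by (auto simp: expos_def lookup_add sum.distrib)

lemma Sq_in_Pol: "p \<in> Pol k n \<Longrightarrow> Sq k r p \<in> Pol k (n + r)"
proof -
  have "Pol k n \<subseteq> {p. Sq k r p \<in> Pol k (n + r)}"
  proof (rule Pol_subsetI)
    fix e assume e: "e \<in> expos k n"
    have "xpow (e + b) \<in> Pol k (n + r)" if "b \<in> expos k r" for b
      using expos_add[OF e that] by (auto simp: Pol_span intro: F2.span_base)
    then show "xpow e \<in> {p. Sq k r p \<in> Pol k (n + r)}"
      by (auto simp: Sq_xpow sq_xpow_def
          intro!: F2.subspace_sum[OF subspace_Pol] F2.subspace_scale[OF subspace_Pol])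
  qed (rule f2_subspace_vimage[OF Sq_add subspace_Pol])
  then show "p \<in> Pol k n \<Longrightarrow> Sq k r p \<in> Pol k (n + r)" by blast
qed

lemma act_in_Pol:
  assumes "\<theta> \<in> steenrod_deg m" "p \<in> Pol k n"
  shows "act k \<theta> p \<in> Pol k (n + m)"
proof -
  obtain x where x: "\<theta> = abs_steenrod x" "\<forall>w\<in>Poly_Mapping.keys x. sum_list (letters w) = m"
    using assms(1) by (auto simp: steenrod_deg_def)
  have "foldr (Sq k) rs p \<in> Pol k (n + sum_list rs)" for rs
  proof (induction rs)
    case (Cons r rs)
    then show ?case
      using Sq_in_Pol[of "foldr (Sq k) rs p" k "n + sum_list rs" r] by (simp add: ac_simps)
  qed (simp add: assms(2))
  then have "word_act k w p \<in> Pol k (n + m)" if "w \<in> Poly_Mapping.keys x" for w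
    using x(2) that by (auto simp: word_act_def)
  then show ?thesis
    unfolding x(1) act.abs_eq free_act_def f2_ext_def
    by (rule F2.subspace_sum[OF subspace_Pol])
qed

section \<open>Exactness of the first square in positive degrees\<close>

lemma expos_1: "expos k (Suc 0) = (\<lambda>i. Poly_Mapping.single i (Suc 0)) ` {..<k}"
proof
  show "expos k (Suc 0) \<subseteq> (\<lambda>i. Poly_Mapping.single i (Suc 0)) ` {..<k}"
  proof
    fix b assume b: "b \<in> expos k (Suc 0)"
    then have "\<exists>i<k. Poly_Mapping.lookup b i \<noteq> 0"
      by (auto simp: expos_def intro: ccontr)
    then obtain i where i: "i < k" "Poly_Mapping.lookup b i \<noteq> 0" by blast
    have eq: "Poly_Mapping.single i (Suc 0) + (b - Poly_Mapping.single i (Suc 0)) = b"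
      using i by (intro poly_mapping_eqI) (auto simp: lookup_add lookup_minus lookup_single when_def)
    then have "b - Poly_Mapping.single i (Suc 0) \<in> expos k 0"
      using expos_add_single[OF i(1), of "b - Poly_Mapping.single i (Suc 0)" 0] b by simp
    with eq i(1) show "b \<in> (\<lambda>i. Poly_Mapping.single i (Suc 0)) ` {..<k}"
      by (auto simp: expos_0)
  qed
  show "(\<lambda>i. Poly_Mapping.single i (Suc 0)) ` {..<k} \<subseteq> expos k (Suc 0)"
    by (auto simp: expos_def sum_single_lessThan[unfolded One_nat_def])
qed

text \<open>
  On monomials $\mathrm{Sq}^1$ is the derivation with $x_i \mapsto x_i^2$, that is
  $x_i^a \mapsto a\,x_i^{a+1}$ in each variable.
\<close>

lemma Sq1_xpow:
  "Sq k 1 (xpow e) =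
    (\<Sum>i<k. of_nat (Poly_Mapping.lookup e i) \<cdot> xpow (e + Poly_Mapping.single i (Suc 0)))"
proof -
  have "bcoeff k e (Poly_Mapping.single i (Suc 0)) = Poly_Mapping.lookup e i" if "i < k" for i
  proof -
    have "bcoeff k e (Poly_Mapping.single i (Suc 0)) =
        (\<Prod>j<k. if j = i then Poly_Mapping.lookup e i else 1)"
      unfolding bcoeff_def by (intro prod.cong) (auto simp: lookup_single when_def)
    with that show ?thesis by simp
  qed
  moreover have "inj_on (\<lambda>i. Poly_Mapping.single i (Suc 0)) {..<k}"
    by (auto intro!: inj_onI dest: arg_cong[where f = Poly_Mapping.keys])
  ultimately show ?thesis
    by (simp add: Sq_xpow sq_xpow_bcoeff expos_1 sum.reindex)
qed

text \<open>
  A contracting homotopy for $\mathrm{Sq}^1$ in positive degrees. In one variable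
  $\mathrm{Sq}^1$ maps $x^a$ to $x^{a+1}$ for odd $a$ and to $0$ for even $a$, so lowering positive even
  exponents by one inverts it on its image; here this is done to the first variable dividing the
  monomial. The monomial $1$ has no such variable, and the value there is an artefact.
\<close>

definition sq1_homotopy :: "pol \<Rightarrow> pol"
  where "sq1_homotopy = f2_ext (\<lambda>e.
    let i = Min (Poly_Mapping.keys e) in
    if even (Poly_Mapping.lookup e i) then xpow (e - Poly_Mapping.single i (Suc 0)) else 0)"

lemma sq1_homotopy_add: "sq1_homotopy (p + q) = sq1_homotopy p + sq1_homotopy q"
  by (simp add: sq1_homotopy_def f2_ext_add)

lemma sq1_homotopy_xpow:
  "sq1_homotopy (xpow e) = (let i = Min (Poly_Mapping.keys e) in
    if even (Poly_Mapping.lookup e i) then xpow (e - Poly_Mapping.single i (Suc 0)) else 0)"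
  by (simp add: sq1_homotopy_def xpow_def)

lemma sq1_homotopy_sum: "sq1_homotopy (\<Sum>i\<in>A. f i) = (\<Sum>i\<in>A. sq1_homotopy (f i))"
  by (induction A rule: infinite_finite_induct)
    (simp_all add: sq1_homotopy_add sq1_homotopy_def[THEN fun_cong, of 0])

lemma sq1_homotopy_scale: "sq1_homotopy (c \<cdot> p) = c \<cdot> sq1_homotopy p"
  by (cases c) (simp_all add: sq1_homotopy_def)

lemma Min_keys_expos:
  assumes "e \<in> expos k n" "n \<noteq> 0"
  shows "Min (Poly_Mapping.keys e) \<in> Poly_Mapping.keys e" "Min (Poly_Mapping.keys e) < k"
proof -
  have "e \<noteq> 0"
    using assms by (auto simp: expos_def)
  then show "Min (Poly_Mapping.keys e) \<in> Poly_Mapping.keys e"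
    by (intro Min_in) simp_all
  with assms(1) show "Min (Poly_Mapping.keys e) < k"
    by (auto simp: expos_def)
qed

lemma sq1_homotopy_in_Pol:
  assumes "n \<noteq> 0" "p \<in> Pol k n"
  shows "sq1_homotopy p \<in> Pol k (n - 1)"
proof -
  have "Pol k n \<subseteq> {p. sq1_homotopy p \<in> Pol k (n - 1)}"
  proof (rule Pol_subsetI)
    fix e assume e: "e \<in> expos k n"
    define i where "i = Min (Poly_Mapping.keys e)"
    have i: "i < k" "Poly_Mapping.lookup e i \<noteq> 0"
      using Min_keys_expos[OF e assms(1)] by (simp_all add: i_def in_keys_iff)
    have "Poly_Mapping.single i (Suc 0) + (e - Poly_Mapping.single i (Suc 0)) = e"
      using i by (intro poly_mapping_eqI) (auto simp: lookup_add lookup_minus lookup_single when_def)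
    then have "e - Poly_Mapping.single i (Suc 0) \<in> expos k (n - 1)"
      using expos_add_single[OF i(1), of "e - Poly_Mapping.single i (Suc 0)" "n - 1"] e assms(1)
      by simp
    then show "xpow e \<in> {p. sq1_homotopy p \<in> Pol k (n - 1)}"
      by (auto simp: sq1_homotopy_xpow Let_def F2.subspace_0[OF subspace_Pol] simp flip: i_def)
        (auto simp: Pol_span intro: F2.span_base)
  qed (rule f2_subspace_vimage[OF sq1_homotopy_add subspace_Pol])
  with assms(2) show ?thesis by blast
qed

text \<open>
  Let $x_i$ be the variable used by the homotopy $h$, with exponent $e_i$. If $e_i$ is odd, $h$ kills
  the monomial, and of the terms of its square only the one raising $e_i$ survives $h$, giving back
  the monomial. If $e_i$ is even, the terms raising other exponents appear in both summands and
  cancel, while the term of $\mathrm{Sq}^1(h(x^e))$ raising the exponent of $x_i$ is the monomial.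
\<close>

lemma Sq1_homotopy_xpow:
  assumes e: "e \<in> expos k n" and n: "n \<noteq> 0"
  shows "Sq k 1 (sq1_homotopy (xpow e)) + sq1_homotopy (Sq k 1 (xpow e)) = xpow e"
proof -
  define i where "i = Min (Poly_Mapping.keys e)"
  define \<delta> :: "nat \<Rightarrow> expo" where "\<delta> j = Poly_Mapping.single j (Suc 0)" for j
  let ?c = "\<lambda>j. of_nat (Poly_Mapping.lookup e j) :: bit"
  have i: "i < k" "Poly_Mapping.lookup e i \<noteq> 0"
    using Min_keys_expos[OF e n] by (simp_all add: i_def in_keys_iff)
  have keys: "Min (Poly_Mapping.keys (e + \<delta> j)) = i" if "Poly_Mapping.lookup e j \<noteq> 0" for j
  proof -
    have "Poly_Mapping.keys (e + \<delta> j) = Poly_Mapping.keys e"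
      using that by (auto simp: in_keys_iff \<delta>_def lookup_add lookup_single when_def split: if_splits)
    then show ?thesis by (simp add: i_def)
  qed
  \<comment> \<open>The square multiplies a monomial only by variables that already divide it, so the variable
    used by the homotopy stays the same.\<close>
  have H: "sq1_homotopy (Sq k 1 (xpow e)) = (\<Sum>j<k. ?c j \<cdot>
      (if even (Poly_Mapping.lookup (e + \<delta> j) i) then xpow (e + \<delta> j - \<delta> i) else 0))"
    unfolding Sq1_xpow sq1_homotopy_sum sq1_homotopy_scale
  proof (rule sum.cong[OF refl])
    fix j
    show "?c j \<cdot> sq1_homotopy (xpow (e + Poly_Mapping.single j (Suc 0))) = ?c j \<cdot>
      (if even (Poly_Mapping.lookup (e + \<delta> j) i) then xpow (e + \<delta> j - \<delta> i) else 0)"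
      using keys[of j] by (cases "Poly_Mapping.lookup e j = 0")
        (simp_all add: sq1_homotopy_xpow Let_def \<delta>_def)
  qed
  have lookup_e: "Poly_Mapping.lookup (e + \<delta> j) i =
      Poly_Mapping.lookup e i + (if j = i then 1 else 0)" for j
    by (simp add: lookup_add \<delta>_def lookup_single)
  have cancel: "e + \<delta> i - \<delta> i = e"
    by simp
  show ?thesis
  proof (cases "even (Poly_Mapping.lookup e i)")
    case False
    then have "sq1_homotopy (Sq k 1 (xpow e)) = (\<Sum>j<k. if j = i then xpow e else 0)"
      unfolding H lookup_e by (intro sum.cong) (auto simp: cancel elim!: oddE)
    also have "\<dots> = xpow e"
      using i by simp
    finally show ?thesis
      using False by (simp add: sq1_homotopy_xpow Let_def flip: i_def)
  next
    case True
    have comm: "e - \<delta> i + \<delta> j = e + \<delta> j - \<delta> i" for j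
      using i by (intro poly_mapping_eqI) (auto simp: \<delta>_def lookup_add lookup_minus lookup_single when_def)
    have "sq1_homotopy (xpow e) = xpow (e - \<delta> i)"
      using True by (simp add: sq1_homotopy_xpow Let_def \<delta>_def flip: i_def)
    then have "Sq k 1 (sq1_homotopy (xpow e)) =
        (\<Sum>j<k. of_nat (Poly_Mapping.lookup (e - \<delta> i) j) \<cdot> xpow (e + \<delta> j - \<delta> i))"
      by (simp only: Sq1_xpow comm \<delta>_def[symmetric])
    also have "\<dots> = (\<Sum>j<k. ?c j \<cdot>
        (if even (Poly_Mapping.lookup (e + \<delta> j) i) then xpow (e + \<delta> j - \<delta> i) else 0) +
        (if j = i then xpow e else 0))"
      using True i unfolding lookup_e
      by (intro sum.cong) (auto simp: \<delta>_def lookup_minus lookup_single when_def of_nat_diff)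
    also have "\<dots> = sq1_homotopy (Sq k 1 (xpow e)) + xpow e"
      unfolding H sum.distrib using i by simp
    finally show ?thesis by (simp add: ac_simps)
  qed
qed

lemma Sq1_homotopy:
  assumes n: "n \<noteq> 0" and p: "p \<in> Pol k n"
  shows "Sq k 1 (sq1_homotopy p) + sq1_homotopy (Sq k 1 p) = p"
proof -
  have "Pol k n \<subseteq> {p. Sq k 1 (sq1_homotopy p) + sq1_homotopy (Sq k 1 p) + p \<in> {0}}"
    by (intro Pol_subsetI f2_subspace_vimage)
      (simp_all add: Sq1_homotopy_xpow[OF _ n] Sq_add sq1_homotopy_add ac_simps del: One_nat_def)
  with p have "Sq k 1 (sq1_homotopy p) + sq1_homotopy (Sq k 1 p) + p = 0" by blast
  then show ?thesis by (simp add: add_eq_0_iff2)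
qed

lemma Sq1_exact:
  assumes "n \<noteq> 0" "p \<in> Pol k n" "Sq k 1 p = 0"
  shows "\<exists>q\<in>Pol k (n - 1). p = Sq k 1 q"
proof (rule bexI[of _ "sq1_homotopy p"])
  show "p = Sq k 1 (sq1_homotopy p)"
    using Sq1_homotopy[OF assms(1,2)] assms(3) by (simp add: sq1_homotopy_def)
qed (rule sq1_homotopy_in_Pol[OF assms(1,2)])

section \<open>The space of tuples and the map of the hit matrix\<close>

text \<open>
  This is $V(k,d)$.
\<close>

definition tuples :: "nat \<Rightarrow> nat \<Rightarrow> tuple set"
  where "tuples k d = F2.span (label_vec ` labels k d)"

lemma subspace_tuples: "F2.subspace (tuples k d)"
  by (simp add: tuples_def)

lemma finite_labels: "finite (labels k d)"
  by (simp add: labels_def finite_levels)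

lemma inj_label_vec: "inj label_vec"
proof (rule injI)
  fix l l' assume "label_vec l = label_vec l'"
  then have eq: "Poly_Mapping.lookup (Poly_Mapping.lookup (label_vec l) t) e =
      Poly_Mapping.lookup (Poly_Mapping.lookup (label_vec l') t) e" for t e by simp
  show "l = l'"
    using eq[of "fst l" "snd l"]
    by (auto simp: label_vec_def xpow_def lookup_single when_def prod_eq_iff split: if_splits)
qed

lemma independent_label_vec: "F2.independent (label_vec ` L)"
proof (rule f2_independentI)
  fix T assume T: "finite T" "T \<subseteq> label_vec ` L" "T \<noteq> {}"
  then obtain L' where L': "finite L'" "T = label_vec ` L'"
    by (metis finite_subset_image)
  from L' T obtain l where l: "l \<in> L'" by auto
  have "Poly_Mapping.lookup (Poly_Mapping.lookup (\<Sum>T) (fst l)) (snd l) =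
      (\<Sum>l'\<in>L'. Poly_Mapping.lookup (Poly_Mapping.lookup (label_vec l') (fst l)) (snd l))"
    by (simp add: L'(2) sum.reindex[OF inj_on_subset[OF inj_label_vec]] lookup_sum)
  also have "\<dots> = (\<Sum>l'\<in>L'. if l' = l then 1 else 0)"
    by (intro sum.cong)
      (auto simp: label_vec_def xpow_def lookup_single when_def prod_eq_iff)
  also have "\<dots> = 1"
    using l L'(1) by simp
  finally show "\<Sum>T \<noteq> 0" by auto
qed

lemma label_span:
  assumes "finite L"
  shows "finite (F2.span (label_vec ` L))" "F2.dim (F2.span (label_vec ` L)) = card L"
  using card_span_independent[OF finite_imageI[OF assms] independent_label_vec]
  by (simp_all add: F2.dim_eq_card_independent[OF independent_label_vec]
      card_image[OF inj_on_subset[OF inj_label_vec]])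

lemma finite_tuples: "finite (tuples k d)"
  and dim_tuples: "F2.dim (tuples k d) = card (labels k d)"
  by (simp_all only: tuples_def label_span[OF finite_labels])

lemma single_in_tuples:
  assumes "2 ^ t \<le> d" "p \<in> Pol k (d - 2 ^ t)"
  shows "Poly_Mapping.single t p \<in> tuples k d"
proof -
  have "Pol k (d - 2 ^ t) \<subseteq> {p. Poly_Mapping.single t p \<in> tuples k d}"
  proof (rule Pol_subsetI)
    fix e assume "e \<in> expos k (d - 2 ^ t)"
    with assms(1) have "label_vec (t, e) \<in> tuples k d"
      unfolding tuples_def by (intro F2.span_base imageI) (simp add: labels_def)
    then show "xpow e \<in> {p. Poly_Mapping.single t p \<in> tuples k d}"
      by (simp add: label_vec_def)
  qed (rule f2_subspace_vimage[OF single_add subspace_tuples])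
  with assms(2) show ?thesis by blast
qed

lemma tuples_memI:
  assumes "\<And>t. t \<in> Poly_Mapping.keys v \<Longrightarrow> 2 ^ t \<le> d \<and> Poly_Mapping.lookup v t \<in> Pol k (d - 2 ^ t)"
  shows "v \<in> tuples k d"
proof -
  have "v = (\<Sum>t\<in>Poly_Mapping.keys v. Poly_Mapping.single t (Poly_Mapping.lookup v t))"
    by (rule poly_mapping_eqI) (auto simp: lookup_sum lookup_single when_def in_keys_iff)
  moreover have "\<dots> \<in> tuples k d"
    by (intro F2.subspace_sum[OF subspace_tuples] single_in_tuples) (auto dest: assms)
  ultimately show ?thesis by simp
qed

lemma hit_map_alt:
  assumes "finite A" "Poly_Mapping.keys v \<subseteq> A"
  shows "hit_map k v = (\<Sum>t\<in>A. Sq k (2 ^ t) (Poly_Mapping.lookup v t))"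
  unfolding hit_map_def using assms
  by (intro sum.mono_neutral_left) (auto simp: in_keys_iff)

lemma hit_map_add: "hit_map k (v + w) = hit_map k v + hit_map k w"
proof -
  let ?A = "Poly_Mapping.keys v \<union> Poly_Mapping.keys w"
  have "hit_map k (v + w) = (\<Sum>t\<in>?A. Sq k (2 ^ t) (Poly_Mapping.lookup (v + w) t))"
    by (intro hit_map_alt) (simp_all add: keys_add)
  then show ?thesis
    by (simp add: lookup_add Sq_add sum.distrib hit_map_alt[of ?A])
qed

lemma hit_map_single: "hit_map k (Poly_Mapping.single t p) = Sq k (2 ^ t) p"
  using hit_map_alt[of "{t}" "Poly_Mapping.single t p" k] by simp

text \<open>
  This is $\ker\Phi_{k,d}$.
\<close>

definition syzygies :: "nat \<Rightarrow> nat \<Rightarrow> tuple set"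
  where "syzygies k d = {v \<in> tuples k d. hit_map k v = 0}"

lemma subspace_syzygies: "F2.subspace (syzygies k d)"
  using F2.subspace_inter[OF subspace_tuples f2_subspace_vimage[of "hit_map k" "{0}", OF hit_map_add]]
  by (simp add: syzygies_def Int_def)

lemma finite_syzygies: "finite (syzygies k d)"
  by (simp add: syzygies_def finite_tuples)

text \<open>
  The columns of the matrix are the coordinate vectors of polynomials in the image of $\Phi_{k,d}$.
  A maximal independent set of columns, of which there are as many as the rank, lifts to a set of
  polynomials in the image; the lift is independent because taking coordinates is additive.
\<close>

lemma rank_hit_matrix: "mat_rank (hit_matrix k d) \<le> F2.dim (hit_map k ` tuples k d)"
proof -
  define A where "A = hit_matrix k d"
  define n where "n = dim_row A"
  define coords :: "pol \<Rightarrow> bit vec"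
    where "coords q = vec n (\<lambda>i. Poly_Mapping.lookup q (hit_rows k d ! i))" for q
  interpret vec_space "TYPE(bit)" n .
  have A: "A \<in> carrier_mat n (dim_col A)"
    by (simp add: n_def)
  have cols: "set (cols A) \<subseteq> coords ` hit_map k ` tuples k d"
  proof
    fix c assume "c \<in> set (cols A)"
    then obtain j where j: "j < dim_col A" "c = col A j"
      by (auto simp: cols_def)
    then have "j < length (hit_cols k d)"
      by (simp add: A_def hit_matrix_def)
    moreover from this have "label_vec (hit_cols k d ! j) \<in> tuples k d"
      unfolding tuples_def set_hit_cols[symmetric] by (intro F2.span_base imageI nth_mem)
    ultimately show "c \<in> coords ` hit_map k ` tuples k d"
      by (intro image_eqI[of _ _ "hit_map k (label_vec (hit_cols k d ! j))"] imageI)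
        (auto simp: j(2) coords_def n_def A_def hit_matrix_def)
  qed
  have "lin_indpt {}"
    unfolding lin_dep_def by blast
  then obtain S where S: "maximal S (\<lambda>T. T \<subseteq> set (cols A) \<and> lin_indpt T)"
    using maximal_exists_superset[of "set (cols A)" "\<lambda>T. T \<subseteq> set (cols A) \<and> lin_indpt T" "{}"]
    by blast
  then have S': "S \<subseteq> set (cols A)" "lin_indpt S"
    by (simp_all add: maximal_def)
  have "S \<subseteq> coords ` hit_map k ` tuples k d"
    using S'(1) cols by (rule order_trans)
  then obtain X where X: "X \<subseteq> hit_map k ` tuples k d" "inj_on coords X" "S = coords ` X"
    unfolding subset_image_inj by blast
  have "F2.independent X"
  proof (rule f2_independentI)
    fix T assume T: "finite T" "T \<subseteq> X" "T \<noteq> {}"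
    have carrier: "coords ` T \<subseteq> carrier_vec n"
      by (auto simp: coords_def)
    have inj: "inj_on coords T"
      using X(2) T(2) by (rule inj_on_subset)
    show "\<Sum>T \<noteq> 0"
    proof
      assume "\<Sum>T = 0"
      then have zero: "(\<Sum>q\<in>T. Poly_Mapping.lookup q e) = 0" for e
        using lookup_sum[of "\<lambda>q. q" T e] by simp
      have "lincomb (\<lambda>_. 1) (coords ` T) = 0\<^sub>v n"
      proof (rule eq_vecI)
        fix i assume "i < dim_vec (0\<^sub>v n :: bit vec)"
        then have i: "i < n" by simp
        have "lincomb (\<lambda>_. 1) (coords ` T) $ i = (\<Sum>x\<in>coords ` T. 1 * x $ i)"
          by (rule lincomb_index[OF i carrier])
        also have "\<dots> = (\<Sum>q\<in>T. coords q $ i)"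
          by (simp only: sum.reindex[OF inj] o_def mult_1)
        also have "\<dots> = (\<Sum>q\<in>T. Poly_Mapping.lookup q (hit_rows k d ! i))"
          using i by (simp only: coords_def index_vec)
        finally show "lincomb (\<lambda>_. 1) (coords ` T) $ i = 0\<^sub>v n $ i"
          using i by (simp only: zero index_zero_vec)
      next
        show "dim_vec (lincomb (\<lambda>_. 1) (coords ` T)) = dim_vec (0\<^sub>v n :: bit vec)"
          using lincomb_dim[OF finite_imageI[OF T(1)] carrier] by simp
      qed
      moreover obtain q where "q \<in> T"
        using T(3) by blast
      ultimately have "lin_dep S"
        using lin_dep_crit[where A = "coords ` T" and S = S and a = "\<lambda>_. 1" and v = "coords q"]
          T(1,2) X(3)
        by (simp add: image_mono)
      with S'(2) show False ..
    qed
  qed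
  moreover have fin: "finite (hit_map k ` tuples k d)"
    by (simp add: finite_tuples)
  moreover have "F2.subspace (hit_map k ` tuples k d)"
    by (rule f2_subspace_image[OF hit_map_add subspace_tuples])
  ultimately have "card X \<le> F2.dim (hit_map k ` tuples k d)"
    using f2_dim_mono[of "F2.span X" "hit_map k ` tuples k d"] X(1)
    by (simp add: F2.span_minimal F2.dim_eq_card_independent)
  moreover have "mat_rank (hit_matrix k d) = card X"
    using rank_card_indpt[OF A S] X(2,3) by (simp add: mat_rank_def card_image n_def A_def)
  ultimately show ?thesis by simp
qed

lemma rank_plus_syzygies:
  assumes "F2.subspace S" "S \<subseteq> syzygies k d"
  shows "mat_rank (hit_matrix k d) + F2.dim S \<le> card (labels k d)"
proof -
  have "F2.dim S \<le> F2.dim (syzygies k d)"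
    using f2_dim_mono[OF assms(1) subspace_syzygies finite_syzygies assms(2)] .
  moreover have "card (labels k d) = F2.dim (syzygies k d) + F2.dim (hit_map k ` tuples k d)"
    using f2_rank_nullity[of "hit_map k", OF hit_map_add subspace_tuples[of k d] finite_tuples]
    by (simp only: dim_tuples syzygies_def)
  ultimately show ?thesis
    using rank_hit_matrix[of k d] by linarith
qed

section \<open>Syzygies from zero columns and from relations\<close>

lemma subspace_E0: "F2.subspace (E0 k d)"
  by (simp add: E0_def)

lemma E0_subset: "E0 k d \<subseteq> syzygies k d"
  unfolding E0_def
proof (rule F2.span_minimal[OF _ subspace_syzygies], clarify)
  fix t g assume "(t, g) \<in> labels k d" "Sq k (2 ^ t) (xpow g) = 0"
  then show "label_vec (t, g) \<in> syzygies k d"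
    by (auto simp: syzygies_def tuples_def label_vec_def[of "(t, g)"] hit_map_single
        intro!: F2.span_base[of "Poly_Mapping.single t (xpow g)"] image_eqI[of _ label_vec "(t, g)"])
qed

lemma act_zero: "act k 0 p = 0"
  by transfer simp

lemma lookup_rel_map: "Poly_Mapping.lookup (rel_map k \<Theta> f) t = act k (Poly_Mapping.lookup \<Theta> t) f"
  unfolding rel_map_def by (simp add: Poly_Mapping.map.rep_eq when_def act_zero)

lemma rel_map_add: "rel_map k \<Theta> (f + g) = rel_map k \<Theta> f + rel_map k \<Theta> g"
  by (rule poly_mapping_eqI) (simp add: lookup_rel_map lookup_add act_add_right)

lemma act_sum: "act k (\<Sum>i\<in>A. h i) p = (\<Sum>i\<in>A. act k (h i) p)"
  by (induction A rule: infinite_finite_induct) (simp_all add: act_add_left act_zero)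

lemma subspace_rel_image: "F2.subspace (rel_image k d r)"
  by (cases r)
    (auto simp: rel_image_def intro!: f2_subspace_image[OF rel_map_add] subspace_Pol)

text \<open>
  The degrees match because $\Theta_t$ raises degree $d-a$ to $(d-a)+(a-2^t) = d-2^t$, and the
  relation in the Steenrod algebra becomes a syzygy by letting it act on $f$.
\<close>

lemma rel_image_subset:
  assumes "homogeneous_relation r"
  shows "rel_image k d r \<subseteq> syzygies k d"
proof -
  obtain a \<Theta> where r: "r = (a, \<Theta>)" by (cases r)
  have hom: "2 ^ t \<le> a" "Poly_Mapping.lookup \<Theta> t \<in> steenrod_deg (a - 2 ^ t)"
    if "t \<in> Poly_Mapping.keys \<Theta>" for t
    using assms that by (simp_all add: r homogeneous_relation_def)
  have rel: "(\<Sum>t\<in>Poly_Mapping.keys \<Theta>. St (2 ^ t) * Poly_Mapping.lookup \<Theta> t) = 0"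
    using assms by (simp add: r homogeneous_relation_def)
  have "rel_map k \<Theta> f \<in> syzygies k d" if a: "a \<le> d" and f: "f \<in> Pol k (d - a)" for f
  proof -
    have keys: "Poly_Mapping.keys (rel_map k \<Theta> f) \<subseteq> Poly_Mapping.keys \<Theta>"
      by (auto simp: in_keys_iff lookup_rel_map act_zero)
    have "rel_map k \<Theta> f \<in> tuples k d"
    proof (rule tuples_memI)
      fix t assume "t \<in> Poly_Mapping.keys (rel_map k \<Theta> f)"
      with keys have t: "t \<in> Poly_Mapping.keys \<Theta>" by blast
      have "d - a + (a - 2 ^ t) = d - 2 ^ t"
        using a hom(1)[OF t] by simp
      then show "2 ^ t \<le> d \<and> Poly_Mapping.lookup (rel_map k \<Theta> f) t \<in> Pol k (d - 2 ^ t)"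
        using act_in_Pol[OF hom(2)[OF t] f] a hom(1)[OF t] by (simp add: lookup_rel_map)
    qed
    moreover have "hit_map k (rel_map k \<Theta> f) =
        act k (\<Sum>t\<in>Poly_Mapping.keys \<Theta>. St (2 ^ t) * Poly_Mapping.lookup \<Theta> t) f"
      by (simp add: hit_map_alt[OF finite_keys keys] lookup_rel_map act_sum act_mult act_St)
    ultimately show ?thesis
      by (simp add: syzygies_def rel act_zero)
  qed
  then show ?thesis
    using F2.subspace_0[OF subspace_syzygies] by (auto simp: r rel_image_def)
qed

lemma subspace_KR: "F2.subspace (KR k d R)"
  by (simp add: KR_def f2_subspace_sum subspace_rel_image)

lemma KR_subset: "\<forall>r\<in>R. homogeneous_relation r \<Longrightarrow> KR k d R \<subseteq> syzygies k d"
  unfolding KR_def by (intro sum_subset_subspace[OF subspace_syzygies] rel_image_subset) blast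

lemma subspace_F1: "F2.subspace (F1 k d)"
  by (simp add: F1_def f2_subspace_plus subspace_E0 subspace_rel_image)

lemma F1_subset: "F1 k d \<subseteq> syzygies k d"
  unfolding F1_def
  by (intro plus_subset_subspace[OF subspace_syzygies] E0_subset rel_image_subset homogeneous_Theta1)

section \<open>The counts as codimensions\<close>

text \<open>
  Summed over any set \<open>L\<close> of levels the counts compare labels with labels of zero columns;
  \<open>L\<close> consists of all levels for $\mathcal W_k$ and of the positive ones for
  $\mathcal W^{(1)}_k$.
\<close>

lemma sum_counts:
  assumes "L \<subseteq> {t. 2 ^ t \<le> d}"
  shows "(\<Sum>t\<in>L. int (Pdim k (d - 2 ^ t)) - int (zeros t k (d - 2 ^ t))) =
    int (card {(t, g) \<in> labels k d. t \<in> L}) -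
    int (card {(t, g) \<in> labels k d. t \<in> L \<and> Sq k (2 ^ t) (xpow g) = 0})"
proof -
  have fin: "finite L"
    using assms finite_levels by (rule finite_subset)
  have "{(t, g) \<in> labels k d. t \<in> L} = (SIGMA t:L. expos k (d - 2 ^ t))"
    "{(t, g) \<in> labels k d. t \<in> L \<and> Sq k (2 ^ t) (xpow g) = 0} =
      (SIGMA t:L. {g \<in> expos k (d - 2 ^ t). Sq k (2 ^ t) (xpow g) = 0})"
    using assms by (auto simp: labels_def)
  then show ?thesis
    using fin by (simp add: card_SigmaI sum_subtractf Pdim_eq zeros_def)
qed

lemma W_eq: "W k d = int (card (labels k d)) - int (F2.dim (E0 k d))"
proof -
  have "W k d = int (card {(t, g) \<in> labels k d. t \<in> {t. 2 ^ t \<le> d}}) -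
      int (card {(t, g) \<in> labels k d. t \<in> {t. 2 ^ t \<le> d} \<and> Sq k (2 ^ t) (xpow g) = 0})"
    unfolding W_def by (rule sum_counts) simp
  also have "{(t, g) \<in> labels k d. t \<in> {t. 2 ^ t \<le> d}} = labels k d"
    by (auto simp: labels_def)
  also have "{(t, g) \<in> labels k d. t \<in> {t. 2 ^ t \<le> d} \<and> Sq k (2 ^ t) (xpow g) = 0} =
      {(t, g) \<in> labels k d. Sq k (2 ^ t) (xpow g) = 0}"
    by (auto simp: labels_def)
  also have "card \<dots> = F2.dim (E0 k d)"
    unfolding E0_def by (rule label_span(2)[symmetric])
      (auto intro: finite_subset[OF _ finite_labels])
  finally show ?thesis .
qed

lemma rel_image_Theta1:
  "rel_image k d Theta1 = (if 2 \<le> d then Poly_Mapping.single 0 ` Sq k 1 ` Pol k (d - 2) else {0})"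
proof -
  have "rel_map k (Poly_Mapping.single 0 (St 1)) f = Poly_Mapping.single 0 (Sq k 1 f)" for f
    by (rule poly_mapping_eqI) (simp add: lookup_rel_map lookup_single when_def act_St act_zero)
  then show ?thesis
    by (simp add: rel_image_def Theta1_def image_image)
qed

text \<open>
  Here exactness enters: adjoining the relation $\mathrm{Sq}^1\mathrm{Sq}^1 = 0$ to the zero columns
  of level $0$ yields exactly the kernel of $\mathrm{Sq}^1$. For $d = 1$ this kernel lives in degree
  $0$, where $\mathrm{Sq}^1$ is not exact, and is supplied by the zero column of the monomial $1$.
\<close>

lemma F1_decomposition:
  assumes d: "1 \<le> d"
  shows "F1 k d =
    F2.span (label_vec ` {(t, g) \<in> labels k d. t \<noteq> 0 \<and> Sq k (2 ^ t) (xpow g) = 0}) +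
    Poly_Mapping.single 0 ` {p \<in> Pol k (d - 1). Sq k 1 p = 0}"
    (is "_ = F2.span (label_vec ` ?L) + ?Z")
proof
  have Z: "F2.subspace ?Z"
    using F2.subspace_inter[OF subspace_Pol f2_subspace_vimage[of "Sq k 1" "{0}", OF Sq_add]]
    by (intro f2_subspace_image[OF single_add]) (simp add: Int_def)
  then have sub: "F2.subspace (F2.span (label_vec ` ?L) + ?Z)"
    by (intro f2_subspace_plus) simp_all
  have L_le: "F2.span (label_vec ` ?L) \<subseteq> F2.span (label_vec ` ?L) + ?Z"
    by (rule subset_plus_left[OF Z])
  have Z_le: "?Z \<subseteq> F2.span (label_vec ` ?L) + ?Z"
    by (rule subset_plus_right) simp
  have "E0 k d \<subseteq> F2.span (label_vec ` ?L) + ?Z"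
    unfolding E0_def
  proof (rule F2.span_minimal[OF _ sub], clarify)
    fix t g assume l: "(t, g) \<in> labels k d" "Sq k (2 ^ t) (xpow g) = 0"
    show "label_vec (t, g) \<in> F2.span (label_vec ` ?L) + ?Z"
    proof (cases "t = 0")
      case True
      then have "xpow g \<in> Pol k (d - 1)"
        using l(1) by (auto simp: labels_def Pol_span intro: F2.span_base)
      with True l(2) have "label_vec (t, g) \<in> ?Z"
        by (simp add: label_vec_def)
      with Z_le show ?thesis by blast
    next
      case False
      with l have "label_vec (t, g) \<in> F2.span (label_vec ` ?L)"
        by (intro F2.span_base imageI) simp
      with L_le show ?thesis by blast
    qed
  qed
  moreover have "rel_image k d Theta1 \<subseteq> ?Z"
  proof -
    \<comment> \<open>That the first square squares to zero is read off from the relation being one.\<close>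
    have "Sq k 1 (Sq k 1 f) = 0" if "f \<in> Pol k (d - 2)" "2 \<le> d" for f
      using rel_image_subset[OF homogeneous_Theta1, of k d] that
      by (auto simp: rel_image_Theta1 syzygies_def hit_map_single image_image image_subset_iff)
    moreover have "Sq k 1 f \<in> Pol k (d - 1)" if "f \<in> Pol k (d - 2)" "2 \<le> d" for f
    proof -
      have "d - 2 + 1 = d - 1"
        using that(2) by simp
      with Sq_in_Pol[OF that(1), of 1] show ?thesis by (simp only:)
    qed
    ultimately show ?thesis
      using F2.subspace_0[OF Z] by (auto simp: rel_image_Theta1)
  qed
  ultimately show "F1 k d \<subseteq> F2.span (label_vec ` ?L) + ?Z"
    unfolding F1_def using Z_le by (intro plus_subset_subspace[OF sub]) auto
next
  have E0_le: "E0 k d \<subseteq> F1 k d"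
    unfolding F1_def by (rule subset_plus_left[OF subspace_rel_image])
  have "F2.span (label_vec ` ?L) \<subseteq> E0 k d"
    unfolding E0_def by (rule F2.span_mono) auto
  moreover have "Poly_Mapping.single 0 p \<in> F1 k d" if p: "p \<in> Pol k (d - 1)" "Sq k 1 p = 0" for p
  proof (cases "d = 1")
    case True
    have "Pol k 0 \<subseteq> {p. Poly_Mapping.single 0 p \<in> E0 k d}"
    proof (rule Pol_subsetI)
      fix e assume e: "e \<in> expos k 0"
      then have "Sq k 1 (xpow e) = 0"
        using Sq_one[of k 0] by (simp add: expos_0 xpow_def)
      with e show "xpow e \<in> {p. Poly_Mapping.single 0 p \<in> E0 k d}"
        unfolding E0_def mem_Collect_eq
        by (intro F2.span_base image_eqI[of _ label_vec "(0, e)"])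
          (simp_all add: label_vec_def labels_def True)
    qed (rule f2_subspace_vimage[OF single_add subspace_E0])
    with p True E0_le show ?thesis by auto
  next
    case False
    with d obtain q where "q \<in> Pol k (d - 2)" "p = Sq k 1 q"
      using Sq1_exact[of "d - 1" p k] p by (auto simp: numeral_2_eq_2)
    with False d have "Poly_Mapping.single 0 p \<in> rel_image k d Theta1"
      by (simp add: rel_image_Theta1)
    then show ?thesis
      using subset_plus_right[OF subspace_E0] unfolding F1_def by blast
  qed
  ultimately show "F2.span (label_vec ` ?L) + ?Z \<subseteq> F1 k d"
    using E0_le by (intro plus_subset_subspace[OF subspace_F1]) auto
qed

text \<open>
  By the decomposition, the level $0$ part of $F_1$ has codimension $\rho_k(d-1)$ by rank and nullity
  for $\mathrm{Sq}^1$, and the part in each positive level has as codimension the number of nonzero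
  columns of that level.
\<close>

lemma W1_eq: "W1 k d = int (card (labels k d)) - int (F2.dim (F1 k d))"
proof (cases "d = 0")
  case True
  then have "F2.dim (F1 k d) \<le> 0"
    using f2_dim_mono[OF subspace_F1 subspace_tuples finite_tuples, of k d k d] F1_subset[of k d]
    by (auto simp: syzygies_def dim_tuples labels_def)
  then show ?thesis
    using True by (simp add: W1_def labels_def)
next
  case False
  then have d: "1 \<le> d" by simp
  let ?L = "{(t, g) \<in> labels k d. t \<noteq> 0 \<and> Sq k (2 ^ t) (xpow g) = 0}"
  let ?K = "{p \<in> Pol k (d - 1). Sq k 1 p = 0}"
  let ?Z = "Poly_Mapping.single 0 ` ?K :: tuple set"
  have K: "F2.subspace ?K"
    using F2.subspace_inter[OF subspace_Pol f2_subspace_vimage[of "Sq k 1" "{0}", OF Sq_add]]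
    by (simp add: Int_def)
  have finK: "finite ?K"
    by (simp add: finite_Pol)
  have inj: "inj_on (Poly_Mapping.single 0) ?K"
    by (auto intro!: inj_onI dest: arg_cong[where f = "\<lambda>v. Poly_Mapping.lookup v 0"])
  have finL: "finite ?L"
    by (rule finite_subset[OF _ finite_labels]) auto
  have Z: "F2.subspace ?Z"
    by (rule f2_subspace_image[OF single_add K])
  have "F2.span (label_vec ` ?L) \<subseteq> {v. Poly_Mapping.lookup v 0 \<in> {0}}"
    by (rule F2.span_minimal[OF _ f2_subspace_vimage[OF lookup_add]])
      (auto simp: label_vec_def lookup_single)
  then have disj: "F2.span (label_vec ` ?L) \<inter> ?Z \<subseteq> {0}"
    by auto
  have "F2.dim (F1 k d) = F2.dim (F2.span (label_vec ` ?L)) + F2.dim ?Z"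
    unfolding F1_decomposition[OF d]
    by (rule f2_dim_direct_sum[OF F2.subspace_span label_span(1)[OF finL] Z finite_imageI[OF finK] disj])
  then have "F2.dim (F1 k d) = card ?L + F2.dim ?K"
    by (simp only: label_span(2)[OF finL] f2_dim_inj_image[OF single_add inj K finK])
  moreover have "Pdim k (d - 1) = F2.dim ?K + rho k (d - 1)"
    unfolding Pdim_def rho_def by (rule f2_rank_nullity[OF Sq_add subspace_Pol finite_Pol])
  moreover have "W1 k d = int (rho k (d - 1)) +
      (int (card {(t, g) \<in> labels k d. t \<noteq> 0}) - int (card ?L))"
  proof -
    let ?T = "{t. 1 \<le> t \<and> 2 ^ t \<le> d}"
    have "(\<Sum>t\<in>?T. int (Pdim k (d - 2 ^ t)) - int (zeros t k (d - 2 ^ t))) =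
        int (card {(t, g) \<in> labels k d. t \<in> ?T}) -
        int (card {(t, g) \<in> labels k d. t \<in> ?T \<and> Sq k (2 ^ t) (xpow g) = 0})"
      by (rule sum_counts) auto
    also have "{(t, g) \<in> labels k d. t \<in> ?T} = {(t, g) \<in> labels k d. t \<noteq> 0}"
      by (auto simp: labels_def)
    also have "{(t, g) \<in> labels k d. t \<in> ?T \<and> Sq k (2 ^ t) (xpow g) = 0} = ?L"
      by (auto simp: labels_def)
    finally show ?thesis
      using False by (simp only: W1_def if_False)
  qed
  moreover have "card (labels k d) = Pdim k (d - 1) + card {(t, g) \<in> labels k d. t \<noteq> 0}"
  proof -
    have "labels k d = {0} \<times> expos k (d - 1) \<union> {(t, g) \<in> labels k d. t \<noteq> 0}"
      using d by (auto simp: labels_def intro: gr0I)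
    moreover have "finite {(t, g) \<in> labels k d. t \<noteq> 0}"
      by (rule finite_subset[OF _ finite_labels]) auto
    ultimately show ?thesis
      using card_Un_disjoint[of "{0} \<times> expos k (d - 1)" "{(t, g) \<in> labels k d. t \<noteq> 0}"]
      by (simp add: Pdim_eq disjoint_iff)
  qed
  ultimately show ?thesis by simp
qed

theorem theorem3p10:
  fixes k d :: nat and R :: "relation set"
  assumes "1 \<le> k"
    and "finite R"
    and "\<forall>r\<in>R. homogeneous_relation r"
  shows "int (mat_rank (hit_matrix k d)) \<le> W1 k d - delta1 k d R \<and>
    W1 k d - delta1 k d R \<le> min (W1 k d) (W k d - Delta k d R)"
proof -
  have K: "F2.subspace (KR k d R)" "KR k d R \<subseteq> syzygies k d"
    using assms(3) by (auto simp: subspace_KR intro: KR_subset[THEN subsetD])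
  have FK: "F2.subspace (F1 k d + KR k d R)" "F1 k d + KR k d R \<subseteq> syzygies k d"
    by (intro f2_subspace_plus subspace_F1 K plus_subset_subspace[OF subspace_syzygies] F1_subset)+
  have fin: "finite (F1 k d + KR k d R)"
    using FK(2) finite_syzygies by (rule finite_subset)
  have "mat_rank (hit_matrix k d) + F2.dim (F1 k d + KR k d R) \<le> card (labels k d)"
    by (rule rank_plus_syzygies[OF FK])
  moreover have "F2.dim (F1 k d) \<le> F2.dim (F1 k d + KR k d R)"
    by (rule f2_dim_mono[OF subspace_F1 FK(1) fin subset_plus_left[OF K(1)]])
  moreover have "F2.dim (E0 k d + KR k d R) \<le> F2.dim (F1 k d + KR k d R)"
    unfolding F1_def
    by (intro f2_dim_mono[OF _ FK(1) fin, unfolded F1_def] f2_subspace_plus subspace_E0 K set_plus_mono2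
        subset_plus_left[OF subspace_rel_image]) simp
  ultimately show ?thesis
    by (simp add: W_eq W1_eq delta1_def Delta_def)
qed

end
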